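(* Let $a<0$, $I=(a,+\infty)$, and let $V\in C^4(I)$ satisfy $\lim_{u\to a^+}V(u)=h^*>0$, $\lim_{u\to a^+}V'(u)=-\infty$, $V(0)=V'(0)=0$, $V''(0)>0$, $uV'(u)>0$ for all $u\in I\setminus\{0\}$, and $V(u)\to+\infty$ as $u\to+\infty$. Suppose that (a) $5(V'''(u))^2-3V''(u)V^{(4)}(u)>0$ for every $u\in I$ with $V''(u)>0$, and (b) $V'(u)V'''(u)<0$ for every $u\in I$ with $V''(u)=0$. Then the extended period function satisfies $T'(h)>0$ for all $h>0$.
   Context: For $h\in(0,h^* )$ let $a<u^-(h)<0<u^+(h)$ be the two solutions of $V(u)=h$; for $h\ge h^*$ let $u^+(h)>0$ be the positive solution of $V(u)=h$. Define $T_p(h)=\sqrt2\int_{u^-(h)}^{u^+(h)}\frac{du}{\sqrt{h-V(u)}}$ for $0<h<h^*$ and $T_b(h)=\sqrt2\int_{a}^{u^+(h)}\frac{du}{\sqrt{h-V(u)}}$ for $h\ge h^*$. The extended period function (of the equation $\ddot u+V'(u)=0$) is $T(h)=T_p(h)$ for $0<h<h^*$ and $T(h)=T_b(h)$ for $h\ge h^*$; it is $C^1$ on $(0,+\infty)$. *)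

theory Defs
  imports "HOL-Analysis.Analysis"
begin

definition nderiv :: "nat \<Rightarrow> (real \<Rightarrow> real) \<Rightarrow> real \<Rightarrow> real" where
  "nderiv k f = (deriv ^^ k) f"

definition Ck_on :: "nat \<Rightarrow> real set \<Rightarrow> (real \<Rightarrow> real) \<Rightarrow> bool" where
  "Ck_on k S f \<longleftrightarrow>
     (\<forall>j<k. \<forall>x\<in>S. (nderiv j f has_real_derivative nderiv (Suc j) f x) (at x))
     \<and> continuous_on S (nderiv k f)"

definition u_minus :: "(real \<Rightarrow> real) \<Rightarrow> real \<Rightarrow> real \<Rightarrow> real" where
  "u_minus V a h = (THE u. a < u \<and> u < 0 \<and> V u = h)"

definition u_plus :: "(real \<Rightarrow> real) \<Rightarrow> real \<Rightarrow> real" where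
  "u_plus V h = (THE u. 0 < u \<and> V u = h)"

text \<open>Period of the periodic orbits (0 < h < h*) and of the bounded orbits (h \<ge> h*);
  the integrals are (improper, absolutely convergent) Henstock-Kurzweil integrals.\<close>
definition T_p :: "(real \<Rightarrow> real) \<Rightarrow> real \<Rightarrow> real \<Rightarrow> real" where
  "T_p V a h = sqrt 2 * integral {u_minus V a h .. u_plus V h} (\<lambda>u. 1 / sqrt (h - V u))"

definition T_b :: "(real \<Rightarrow> real) \<Rightarrow> real \<Rightarrow> real \<Rightarrow> real" where
  "T_b V a h = sqrt 2 * integral {a .. u_plus V h} (\<lambda>u. 1 / sqrt (h - V u))"

definition ext_period :: "(real \<Rightarrow> real) \<Rightarrow> real \<Rightarrow> real \<Rightarrow> real \<Rightarrow> real" where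
  "ext_period V a hs h = (if h < hs then T_p V a h else T_b V a h)"

end

theory Submission
  imports Defs
begin

text \<open>
  With \<open>\<sigma> u = sgn u * sqrt (V u)\<close> and its inverse \<open>\<phi>\<close>, extended by the constant \<open>a\<close> below
  \<open>- sqrt hs\<close>, the substitution \<open>u = \<phi> (sqrt h * sin t)\<close> turns both branches of the period into
  the single formula \<open>T h = sqrt 2 * \<integral> \<phi>' (sqrt h * sin t) dt\<close> over \<open>[-pi/2, pi/2]\<close>.
  Away from \<open>0\<close> and \<open>- sqrt hs\<close> one has \<open>\<phi>'' r = 2 * M (\<phi> r)\<close> with \<open>M = (V / V'\<^sup>2)'\<close>
  (and \<open>\<phi>'' = 0\<close> below \<open>- sqrt hs\<close>).
  Condition (a) makes \<open>M\<close> strictly increasing as long as \<open>V'' > 0\<close>, and condition (b) controls the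
  region \<open>V'' \<le> 0\<close>, so that \<open>M < M0\<close> on the left of \<open>0\<close> and \<open>M > M0\<close> on the right,
  where \<open>M0 > 0\<close> is the limit of \<open>M\<close> at \<open>0\<close>. As \<open>sin\<close> is odd, subtracting \<open>2 * M0\<close> from
  \<open>\<phi>''\<close> does not change \<open>T' h\<close>, and the integrand becomes positive.
\<close>

section \<open>Zeros and sign changes of real functions\<close>

lemma compact_zeros:
  fixes f :: "real \<Rightarrow> real"
  assumes "continuous_on {l..u} f"
  shows "compact {x \<in> {l..u}. f x = 0}"
proof -
  have "closed {x \<in> {l..u}. f x = 0}"
    using assms by (rule continuous_closed_preimage_constant) simp
  moreover have "bounded {x \<in> {l..u}. f x = 0}"
    by (rule bounded_subset[OF bounded_closed_interval[of l u]]) auto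
  ultimately show ?thesis by (simp add: compact_eq_bounded_closed)
qed

text \<open>If \<open>f u > 0\<close>, the last zero \<open>c\<close> before \<open>u\<close> exists
  by compactness. The negative slope at \<open>c\<close> pushes \<open>f\<close> below zero just
  after it, so the intermediate value theorem yields a zero beyond \<open>c\<close>, a
  contradiction.\<close>

lemma nonpos_after_downcrossing:
  fixes f f' :: "real \<Rightarrow> real"
  assumes "b \<le> u" and "f b \<le> 0"
    and der: "\<And>x. b \<le> x \<Longrightarrow> x \<le> u \<Longrightarrow> (f has_real_derivative f' x) (at x)"
    and neg: "\<And>x. b \<le> x \<Longrightarrow> x \<le> u \<Longrightarrow> f x = 0 \<Longrightarrow> f' x < 0"
  shows "f u \<le> 0"
proof (rule ccontr)
  assume "\<not> f u \<le> 0"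
  then have fu: "f u > 0" by simp
  have cont: "continuous_on {b..u} f"
    by (rule DERIV_continuous_on[where D = f']) (use der in \<open>auto intro: has_field_derivative_at_within\<close>)
  let ?Z = "{x \<in> {b..u}. f x = 0}"
  have "compact ?Z" by (rule compact_zeros[OF cont])
  moreover have "?Z \<noteq> {}"
    using IVT'[of f b 0 u] assms(1,2) fu cont by auto
  ultimately obtain c where c: "c \<in> ?Z" "\<And>x. x \<in> ?Z \<Longrightarrow> x \<le> c"
    using compact_attains_sup[of ?Z] by auto
  have "c < u" using c fu by (cases "c = u") auto
  have "f' c < 0" using c neg by auto
  with DERIV_neg_dec_right[OF der[of c]] c obtain d where d: "d > 0" "\<And>h. 0 < h \<Longrightarrow> h < d \<Longrightarrow> f (c + h) < f c"
    by auto
  define h where "h = min (d/2) ((u - c)/2)"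
  have h: "0 < h" "h < d" "c + h < u" using d \<open>c < u\<close> by (auto simp: h_def min_def field_simps)
  then have "f (c + h) < 0" using d c by auto
  then obtain x where "c + h \<le> x" "x \<le> u" "f x = 0"
    using IVT'[of f "c + h" 0 u] fu h c cont continuous_on_subset[OF cont, of "{c + h..u}"] by auto
  then have "x \<in> ?Z" using c h by auto
  then show False using c(2)[of x] \<open>c + h \<le> x\<close> h by auto
qed

text \<open>The least zero works: a nonpositive value before it would produce a smaller
  zero.\<close>

lemma first_zero:
  fixes f :: "real \<Rightarrow> real"
  assumes "l < u" "f l > 0" "f u \<le> 0" and cont: "continuous_on {l..u} f"
  obtains b where "l < b" "b \<le> u" "f b = 0" "\<And>x. l \<le> x \<Longrightarrow> x < b \<Longrightarrow> f x > 0"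
proof -
  let ?Z = "{x \<in> {l..u}. f x = 0}"
  have "compact ?Z" by (rule compact_zeros[OF cont])
  moreover have "?Z \<noteq> {}"
    using IVT2'[of f u 0 l] assms by auto
  ultimately obtain b where b: "b \<in> ?Z" "\<And>x. x \<in> ?Z \<Longrightarrow> b \<le> x"
    using compact_attains_inf[of ?Z] by auto
  show ?thesis
  proof (rule that)
    show "l < b" using b assms by (cases "b = l") auto
    fix x assume x: "l \<le> x" "x < b"
    show "f x > 0"
    proof (rule ccontr)
      assume "\<not> f x > 0"
      then obtain y where "l \<le> y" "y \<le> x" "f y = 0"
        using IVT2'[of f x 0 l] assms x b continuous_on_subset[OF cont, of "{l..x}"] by auto
      then show False using b(2)[of y] x b by force
    qed
  qed (use b in auto)
qed

section \<open>Differentiating an average of \<open>H (sqrt h * sin t)\<close> under the integral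
  sign\<close>

text \<open>The mean value theorem would need a derivative at every interior point; the fundamental
  theorem of calculus tolerates the finite set \<open>E\<close>, so the increment is the integral of
  \<open>H'\<close>, bounded by \<open>B\<close> times the length.\<close>

lemma lipschitz_bound_finite_exceptions:
  fixes H H' :: "real \<Rightarrow> real"
  assumes "finite E" "continuous_on UNIV H"
    and der: "\<And>r. r \<notin> E \<Longrightarrow> (H has_real_derivative H' r) (at r)"
    and bnd: "\<And>r. r \<notin> E \<Longrightarrow> \<bar>r\<bar> \<le> R \<Longrightarrow> \<bar>H' r\<bar> \<le> B"
    and "0 \<le> B" "\<bar>x\<bar> \<le> R" "\<bar>y\<bar> \<le> R"
  shows "\<bar>H y - H x\<bar> \<le> B * \<bar>y - x\<bar>"
proof -
  have *: "\<bar>H y - H x\<bar> \<le> B * (y - x)" if "x \<le> y" "\<bar>x\<bar> \<le> R" "\<bar>y\<bar> \<le> R" for x y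
  proof -
    have "(H' has_integral (H y - H x)) {x..y}"
      using assms(1,2) that der
      by (intro fundamental_theorem_of_calculus_interior_strong[of E])
         (auto simp: has_real_derivative_iff_has_vector_derivative[symmetric] intro: continuous_on_subset)
    then have "norm (H y - H x) \<le> B * measure lborel {x..y}"
      by (rule has_integral_bound_real[rotated 2]) (use assms that bnd in auto)
    then show ?thesis using that by simp
  qed
  show ?thesis
    using *[of x y] *[of y x] assms by (cases "x \<le> y") (auto simp: abs_minus_commute)
qed

lemma integral_sin_sym: "((\<lambda>t. sin t) has_integral 0) {-pi/2..pi/2}"
proof -
  have "((\<lambda>t. sin t) has_integral (- cos (pi/2) - (- cos (-pi/2)))) {-pi/2..pi/2}"
    by (rule fundamental_theorem_of_calculus)
       (auto intro!: derivative_eq_intros simp: has_real_derivative_iff_has_vector_derivative[symmetric])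
  then show ?thesis by simp
qed

text \<open>A nonnegative function with zero integral vanishes almost everywhere; as
  \<open>f\<close> vanishes nowhere on \<open>S\<close>, this would put \<open>S\<close> inside a
  null set.\<close>

lemma integral_pos_non_negligible:
  fixes f :: "'a::euclidean_space \<Rightarrow> real"
  assumes int: "f integrable_on S" and pos: "\<And>x. x \<in> S \<Longrightarrow> f x > 0" and "\<not> negligible S"
  shows "integral S f > 0"
proof -
  have abs: "f absolutely_integrable_on S"
    using int pos by (intro nonnegative_absolutely_integrable_1) (auto intro: less_imp_le)
  have "integral S f \<noteq> 0"
  proof
    assume "integral S f = 0"
    then have "(LINT x|lebesgue. indicator S x *\<^sub>R f x) = 0"
      using set_lebesgue_integral_eq_integral(2)[OF abs] by (simp add: set_lebesgue_integral_def)
    then have "AE x in lebesgue. indicator S x *\<^sub>R f x = 0"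
      using abs unfolding set_integrable_def
      by (subst (asm) integral_nonneg_eq_0_iff_AE) (auto simp: indicator_def intro: less_imp_le pos)
    then obtain N where N: "N \<in> null_sets lebesgue" "{x. indicator S x *\<^sub>R f x \<noteq> 0} \<subseteq> N"
      by (auto simp: eventually_ae_filter)
    then have "S \<subseteq> N" using pos by (force simp: indicator_def)
    then show False using N \<open>\<not> negligible S\<close> negligible_subset negligible_iff_null_sets by blast
  qed
  moreover have "integral S f \<ge> 0"
    using int pos by (intro integral_nonneg) (auto intro: less_imp_le)
  ultimately show ?thesis by simp
qed

text \<open>Dominated convergence for the difference quotients in \<open>h\<close>: the local
  Lipschitz bound dominates them, and off finitely many \<open>t\<close> they converge to
  \<open>\<kappa> r * r / (2 * h)\<close> with \<open>r = sqrt h * sin t\<close>, which is positive.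
  Exceptional points are allowed because the function to which this is applied has its derivative
  computed only away from \<open>0\<close> and \<open>- sqrt hs\<close>.\<close>

lemma angular_average_deriv_pos:
  fixes H \<kappa> :: "real \<Rightarrow> real"
  assumes E: "finite E" "0 \<in> E" and cont: "continuous_on UNIV H"
    and der: "\<And>r. r \<notin> E \<Longrightarrow> (H has_real_derivative \<kappa> r) (at r)"
    and pos: "\<And>r. r \<notin> E \<Longrightarrow> \<kappa> r * r > 0"
    and bnd: "\<And>R. \<exists>B. \<forall>r. r \<notin> E \<longrightarrow> \<bar>r\<bar> \<le> R \<longrightarrow> \<bar>\<kappa> r\<bar> \<le> B"
    and h: "h > 0"
  shows "\<exists>D>0. ((\<lambda>h. integral {-pi/2..pi/2} (\<lambda>t. H (sqrt h * sin t))) has_real_derivative D) (at h)"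
proof -
  let ?I = "{-pi/2..pi/2}"
  define F where "F = (\<lambda>h. integral ?I (\<lambda>t. H (sqrt h * sin t)))"
  define N where "N = {t \<in> ?I. sqrt h * sin t \<in> E}"
  define S where "S = ?I - N"
  define G where "G = (\<lambda>t. \<kappa> (sqrt h * sin t) * (sin t / (2 * sqrt h)))"
  \<comment> \<open>\<open>sin\<close> is injective on the interval, so each point of
    \<open>E\<close> is hit at most once.\<close>
  have finN: "finite N"
  proof (rule finite_imageD)
    show "finite ((\<lambda>t. sqrt h * sin t) ` N)"
      by (rule finite_subset[OF _ E(1)]) (auto simp: N_def)
    show "inj_on (\<lambda>t. sqrt h * sin t) N"
      using h by (auto simp: inj_on_def N_def intro: sin_inj_pi)
  qed
  have negN: "negligible N" using finN by (rule negligible_finite)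
  have contH: "continuous_on A (\<lambda>t. H (c * sin t))" for A c
    by (rule continuous_on_compose2[OF cont]) (auto intro!: continuous_intros)
  have intH: "(\<lambda>t. H (c * sin t)) integrable_on ?I" for c
    by (rule integrable_continuous_real) (rule contH)
  \<comment> \<open>The radius \<open>sqrt (2*h)\<close> covers all arguments
    \<open>sqrt x * sin t\<close> with \<open>0 < x\<close> and \<open>x \<le> 2*h\<close>, the
    range to which sequences are confined below.\<close>
  obtain B0 where B0: "\<And>r. r \<notin> E \<Longrightarrow> \<bar>r\<bar> \<le> sqrt (2*h) \<Longrightarrow> \<bar>\<kappa> r\<bar> \<le> B0"
    using bnd[of "sqrt (2*h)"] by blast
  define B where "B = max B0 0"
  have lip: "\<bar>H y - H x\<bar> \<le> B * \<bar>y - x\<bar>" if "\<bar>x\<bar> \<le> sqrt (2*h)" "\<bar>y\<bar> \<le> sqrt (2*h)" for x y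
    by (rule lipschitz_bound_finite_exceptions[OF E(1) cont der _ _ that])
       (use B0 in \<open>force simp: B_def max_def\<close>)+
  have main: "G integrable_on S \<and> (\<lambda>n. (F (X n) - F h) / (X n - h)) \<longlonglongrightarrow> integral S G"
    if X: "\<And>n. X n \<noteq> h" "\<And>n. 0 < X n" "\<And>n. X n \<le> 2*h" "X \<longlonglongrightarrow> h" for X
  proof -
    define f where "f = (\<lambda>n t. (H (sqrt (X n) * sin t) - H (sqrt h * sin t)) / (X n - h))"
    have fI: "(f n has_integral ((F (X n) - F h) / (X n - h))) ?I" for n
      unfolding f_def F_def
      by (intro has_integral_divide has_integral_diff integrable_integral intH)
    have fS: "(f n has_integral ((F (X n) - F h) / (X n - h))) S" for n
      using fI[of n]
      by (rule has_integral_spike_set_eq[THEN iffD1, rotated 2])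
         (auto simp: S_def intro: negligible_subset[OF negN])
    have bd: "norm (f n t) \<le> B / sqrt h" for n t
    proof -
      have 1: "\<bar>sqrt (X n) * sin t\<bar> \<le> sqrt (2*h)" "\<bar>sqrt h * sin t\<bar> \<le> sqrt (2*h)"
        using X(2,3)[of n] h abs_sin_le_one[of t]
          mult_mono[of "sqrt (X n)" "sqrt (2*h)" "\<bar>sin t\<bar>" 1]
          mult_mono[of "sqrt h" "sqrt (2*h)" "\<bar>sin t\<bar>" 1]
        by (auto simp: abs_mult)
      \<comment> \<open>This factorisation turns the Lipschitz bound in \<open>sqrt h\<close> into
        one in \<open>h\<close>, at the cost of the factor \<open>1 / sqrt h\<close>.\<close>
      have "X n - h = (sqrt (X n) - sqrt h) * (sqrt (X n) + sqrt h)"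
        using X(2)[of n] h by (simp add: algebra_simps)
      then have 2: "\<bar>X n - h\<bar> = \<bar>sqrt (X n) - sqrt h\<bar> * (sqrt (X n) + sqrt h)"
        using X(2)[of n] h by (simp add: abs_mult)
      have "\<bar>H (sqrt (X n) * sin t) - H (sqrt h * sin t)\<bar> \<le> B * \<bar>sqrt (X n) * sin t - sqrt h * sin t\<bar>"
        by (rule lip[OF 1(2) 1(1)])
      also have "\<bar>sqrt (X n) * sin t - sqrt h * sin t\<bar> = \<bar>sqrt (X n) - sqrt h\<bar> * \<bar>sin t\<bar>"
        by (simp add: abs_mult[symmetric] algebra_simps)
      also have "B * \<dots> \<le> B * \<bar>sqrt (X n) - sqrt h\<bar>"
        using abs_sin_le_one[of t] by (intro mult_left_mono) (auto simp: B_def mult_left_le)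
      also have "\<dots> \<le> B / sqrt h * \<bar>X n - h\<bar>"
      proof -
        have "sqrt h \<le> sqrt (X n) + sqrt h" using X(2)[of n] by simp
        then have "\<bar>sqrt (X n) - sqrt h\<bar> * sqrt h \<le> \<bar>X n - h\<bar>"
          unfolding 2 by (intro mult_left_mono) auto
        then have "B * (\<bar>sqrt (X n) - sqrt h\<bar> * sqrt h) \<le> B * \<bar>X n - h\<bar>"
          by (intro mult_left_mono) (auto simp: B_def)
        then show ?thesis using h by (simp add: field_simps)
      qed
      finally show ?thesis using X(1)[of n] by (simp add: f_def field_simps)
    qed
    have lim: "(\<lambda>n. f n t) \<longlonglongrightarrow> G t" if "t \<in> S" for t
    proof -
      have nE: "sqrt h * sin t \<notin> E" using that by (auto simp: S_def N_def)
      have "((\<lambda>x. H (sqrt x * sin t)) has_real_derivative G t) (at h)"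
        unfolding G_def
        by (rule DERIV_chain2[where f = H and g = "\<lambda>x. sqrt x * sin t", OF der[OF nE]])
           (use h in \<open>auto intro!: derivative_eq_intros simp: field_simps\<close>)
      then have "((\<lambda>x. (H (sqrt x * sin t) - H (sqrt h * sin t)) / (x - h)) \<longlongrightarrow> G t) (at h)"
        by (simp add: has_field_derivative_iff)
      then show ?thesis
        unfolding f_def tendsto_at_iff_sequentially comp_def using X by auto
    qed
    have c: "(\<lambda>t. B / sqrt h) integrable_on S"
      by (rule integrable_spike_set[of _ ?I]) (auto simp: S_def intro: negligible_subset[OF negN])
    have "G integrable_on S" "(\<lambda>n. integral S (f n)) \<longlonglongrightarrow> integral S G"
      using dominated_convergence[of f S "\<lambda>t. B / sqrt h" G] fS c bd lim by blast+
    moreover have "integral S (f n) = (F (X n) - F h) / (X n - h)" for n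
      using fS by (rule integral_unique)
    ultimately show ?thesis by simp
  qed
  \<comment> \<open>One concrete admissible sequence suffices to extract the integrability of
    \<open>G\<close> from \<open>main\<close>.\<close>
  have "(\<lambda>n. h + h / real (Suc n)) \<longlonglongrightarrow> h"
    using tendsto_add[OF tendsto_const LIMSEQ_Suc[OF lim_const_over_n[of h]], of h] by simp
  then have Gint: "G integrable_on S"
    using h main[of "\<lambda>n. h + h / real (Suc n)"]
    by (simp add: add_pos_pos frac_le[of h h 1, simplified])
  have Gpos: "G t > 0" if "t \<in> S" for t
  proof -
    have "sqrt h * sin t \<notin> E" using that by (auto simp: S_def N_def)
    from pos[OF this] have "\<kappa> (sqrt h * sin t) * (sqrt h * sin t) > 0" .
    then have "\<kappa> (sqrt h * sin t) * (sqrt h * sin t) / (2 * h) > 0" using h by simp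
    also have "\<kappa> (sqrt h * sin t) * (sqrt h * sin t) / (2 * h) = G t"
      using h real_sqrt_mult_self[of h] by (simp add: G_def field_simps del: real_sqrt_mult_self)
    finally show ?thesis .
  qed
  have "\<not> negligible S"
  proof
    assume "negligible S"
    then have "negligible (S \<union> N)" using negN by (rule negligible_Un)
    then have "negligible (cbox (-pi/2) (pi/2))" by (rule negligible_subset) (auto simp: S_def)
    then show False unfolding negligible_interval using pi_gt_zero by simp
  qed
  then have "integral S G > 0" using Gint Gpos by (intro integral_pos_non_negligible) auto
  moreover have "(F has_real_derivative integral S G) (at h)"
    unfolding has_field_derivative_iff tendsto_at_iff_sequentially comp_def
  proof (intro allI impI)
    fix X :: "nat \<Rightarrow> real" assume X: "\<forall>i. X i \<in> UNIV - {h}" "X \<longlonglongrightarrow> h"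
    \<comment> \<open>\<open>main\<close> requires the bounds for every index, so an initial segment
      of \<open>X\<close> is dropped.\<close>
    have "\<forall>\<^sub>F n in sequentially. X n \<in> {0<..<2*h}"
      using X(2) h by (intro topological_tendstoD[of X h]) auto
    then obtain n0 where n0: "\<And>n. n \<ge> n0 \<Longrightarrow> X n \<in> {0<..<2*h}"
      by (auto simp: eventually_sequentially)
    have bounds: "0 < X (n + n0)" "X (n + n0) \<le> 2 * h" for n
      using n0[of "n + n0"] by auto
    have "(\<lambda>n. X (n + n0)) \<longlonglongrightarrow> h" using X(2) by (rule LIMSEQ_ignore_initial_segment)
    then have "(\<lambda>n. (F (X (n + n0)) - F h) / (X (n + n0) - h)) \<longlonglongrightarrow> integral S G"
      using main[of "\<lambda>n. X (n + n0)"] bounds X(1) by auto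
    then show "(\<lambda>n. (F (X n) - F h) / (X n - h)) \<longlonglongrightarrow> integral S G"
      by (rule LIMSEQ_offset)
  qed
  ultimately show ?thesis unfolding F_def by blast
qed

section \<open>The potential: signs, monotonicity and convexity on the left\<close>

locale schaaf_potential =
  fixes V V1 V2 V3 V4 :: "real \<Rightarrow> real" and a hs :: real
  assumes a_neg: "a < 0" and hs_pos: "hs > 0"
    and dV: "\<And>u. a < u \<Longrightarrow> (V has_real_derivative V1 u) (at u)"
    and dV1: "\<And>u. a < u \<Longrightarrow> (V1 has_real_derivative V2 u) (at u)"
    and dV2: "\<And>u. a < u \<Longrightarrow> (V2 has_real_derivative V3 u) (at u)"
    and dV3: "\<And>u. a < u \<Longrightarrow> (V3 has_real_derivative V4 u) (at u)"
    and lim_V: "(V \<longlongrightarrow> hs) (at_right a)"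
    and lim_V1: "filterlim V1 at_bot (at_right a)"
    and V_0: "V 0 = 0" and V1_0: "V1 0 = 0" and V2_0: "V2 0 > 0"
    and V1_sign: "\<And>u. a < u \<Longrightarrow> u \<noteq> 0 \<Longrightarrow> u * V1 u > 0"
    and V_inf: "filterlim V at_top at_top"
    and schaaf: "\<And>u. a < u \<Longrightarrow> V2 u > 0 \<Longrightarrow> 5 * (V3 u)^2 - 3 * V2 u * V4 u > 0"
    and inflection: "\<And>u. a < u \<Longrightarrow> V2 u = 0 \<Longrightarrow> V1 u * V3 u < 0"
begin

lemma V1_pos: "u > 0 \<Longrightarrow> V1 u > 0"
  using V1_sign[of u] a_neg by (simp add: zero_less_mult_iff)

lemma V1_neg: "a < u \<Longrightarrow> u < 0 \<Longrightarrow> V1 u < 0"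
  using V1_sign[of u] by (simp add: zero_less_mult_iff)

lemma V1_nonzero: "a < u \<Longrightarrow> u \<noteq> 0 \<Longrightarrow> V1 u \<noteq> 0"
  using V1_sign[of u] by auto

lemma isCont_potential:
  assumes "a < u"
  shows "isCont V u" "isCont V1 u" "isCont V2 u" "isCont V3 u"
  using assms dV dV1 dV2 dV3 DERIV_isCont by blast+

lemma V_less:
  assumes "0 \<le> x" "x < y"
  shows "V x < V y"
proof (rule DERIV_pos_imp_increasing_open[OF assms(2)])
  show "\<exists>D. (V has_real_derivative D) (at z) \<and> 0 < D" if "x < z" for z
    using V1_pos[of z] dV[of z] a_neg assms that by auto
  show "continuous_on {x..y} V"
    using a_neg assms by (auto intro!: continuous_at_imp_continuous_on isCont_potential)
qed

lemma V_greater: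
  assumes "a < x" "x < y" "y \<le> 0"
  shows "V y < V x"
proof (rule DERIV_neg_imp_decreasing_open[OF assms(2)])
  show "\<exists>D. (V has_real_derivative D) (at z) \<and> D < 0" if "x < z" "z < y" for z
    using V1_neg[of z] dV[of z] assms that by auto
  show "continuous_on {x..y} V"
    using assms by (auto intro!: continuous_at_imp_continuous_on isCont_potential)
qed

lemma V_pos: "a < u \<Longrightarrow> u \<noteq> 0 \<Longrightarrow> V u > 0"
  using V_less[of 0 u] V_greater[of u 0] V_0 by (cases "u > 0") auto

lemma V_less_hs:
  assumes "a < u" "u \<le> 0"
  shows "V u < hs"
proof -
  \<comment> \<open>Passing to the limit at \<open>a\<close> only gives a weak inequality; the
    intermediate point \<open>w\<close> restores strictness.\<close>
  obtain w where w: "a < w" "w < u" using assms dense by blast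
  have "V w \<le> hs"
  proof (rule tendsto_lowerbound[OF lim_V])
    show "\<forall>\<^sub>F x in at_right a. V w \<le> V x"
      using eventually_at_right_real[OF w(1)]
      by eventually_elim (use V_greater[of _ w] w assms in \<open>auto intro: less_imp_le\<close>)
  qed simp
  moreover have "V u < V w" using V_greater[of w u] w assms by auto
  ultimately show ?thesis by simp
qed

text \<open>By the inflection condition, zeros of \<open>V2\<close> on the left can only be crossed upwards, and a
  nonpositive \<open>V2\<close> near \<open>a\<close> would keep \<open>V1\<close> bounded below there.\<close>

lemma V2_pos_left:
  assumes "a < u" "u \<le> 0"
  shows "V2 u > 0"
proof (rule ccontr)
  assume nonpos: "\<not> V2 u > 0"
  have "u < 0" using nonpos V2_0 assms by (cases "u = 0") auto
  have V2_nonpos: "V2 w \<le> 0" if "a < w" "w \<le> u" for w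
  proof -
    \<comment> \<open>The crossing lemma moves to the right, so the line is reflected.\<close>
    have "(\<lambda>x. V2 (- x)) (- w) \<le> 0"
    proof (rule nonpos_after_downcrossing[where b = "-u" and f = "\<lambda>x. V2 (- x)" and f' = "\<lambda>x. - V3 (- x)"])
      fix x assume x: "- u \<le> x" "x \<le> - w"
      show "((\<lambda>x. V2 (- x)) has_real_derivative - V3 (- x)) (at x)"
        using dV2[of "- x"] x that by (simp add: DERIV_mirror)
      assume "V2 (- x) = 0"
      then have "V1 (- x) * V3 (- x) < 0" using inflection[of "- x"] x that by simp
      moreover have "V1 (- x) < 0" using V1_neg[of "- x"] x that \<open>u < 0\<close> by simp
      ultimately show "- V3 (- x) < 0" by (simp add: mult_less_0_iff)
    qed (use nonpos that in auto)
    then show ?thesis by simp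
  qed
  have "V1 w \<ge> V1 u" if "a < w" "w \<le> u" for w
    by (rule DERIV_nonpos_imp_nonincreasing[OF that(2)]) (use that dV1 V2_nonpos in force)
  moreover have "\<forall>\<^sub>F w in at_right a. V1 w < V1 u"
    using lim_V1 by (simp add: filterlim_at_bot_dense)
  then have "\<forall>\<^sub>F w in at_right a. V1 w < V1 u \<and> a < w \<and> w < u"
    using eventually_at_right_real[OF assms(1)] by eventually_elim auto
  then obtain w where "V1 w < V1 u" "a < w" "w < u"
    using eventually_happens'[OF trivial_limit_at_right_real] by blast
  ultimately show False by force
qed

section \<open>Monotonicity of \<open>M\<close>\<close>

text \<open>Away from \<open>0\<close>, \<open>A u / (V1 u)^5\<close> is the third derivative of the
  local inverse of \<open>V\<close>, taken at \<open>V u\<close>.\<close>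

definition A :: "real \<Rightarrow> real" where
  "A u = 3 * (V2 u)^2 - V1 u * V3 u"

definition M :: "real \<Rightarrow> real" where
  "M u = ((V1 u)^2 - 2 * V u * V2 u) / (V1 u)^3"

definition M0 :: real where
  "M0 = - V3 0 / (3 * (V2 0)^2)"

lemma dA: "a < u \<Longrightarrow> (A has_real_derivative (5 * V2 u * V3 u - V1 u * V4 u)) (at u)"
  unfolding A_def
  by (auto intro!: derivative_eq_intros dV1 dV2 dV3 simp: algebra_simps)

text \<open>The powers 3 and 5 are chosen so that the terms in \<open>(V2 u)^2 * V3 u\<close> cancel
  in \<open>3 * V2 * A' - 5 * A * V3\<close>; what remains is \<open>V1\<close> times the expression
  in condition (a).\<close>

lemma dA_normalised:
  assumes "a < u" "V2 u > 0"
  shows "((\<lambda>u. (A u)^3 / (V2 u)^5) has_real_derivative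
    (A u)^2 * V1 u * (5 * (V3 u)^2 - 3 * V2 u * V4 u) / (V2 u)^6) (at u)"
proof -
  have "((\<lambda>u. (A u)^3 / (V2 u)^5) has_real_derivative
     (3 * (A u)^2 * (5 * V2 u * V3 u - V1 u * V4 u) * (V2 u)^5 - (A u)^3 * (5 * (V2 u)^4 * V3 u))
       / ((V2 u)^5 * (V2 u)^5)) (at u)"
    using assms by (auto intro!: derivative_eq_intros dA dV2)
  also have "3 * (A u)^2 * (5 * V2 u * V3 u - V1 u * V4 u) * (V2 u)^5 - (A u)^3 * (5 * (V2 u)^4 * V3 u)
    = (A u)^2 * (V2 u)^4 * (V2 u * 3 * (5 * V2 u * V3 u - V1 u * V4 u) - A u * 5 * V3 u)"
    by algebra
  also have "V2 u * 3 * (5 * V2 u * V3 u - V1 u * V4 u) - A u * 5 * V3 u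
    = V1 u * (5 * (V3 u)^2 - 3 * V2 u * V4 u)"
    unfolding A_def by algebra
  also have "(A u)^2 * (V2 u)^4 * (V1 u * (5 * (V3 u)^2 - 3 * V2 u * V4 u)) / ((V2 u)^5 * (V2 u)^5)
    = (A u)^2 * V1 u * (5 * (V3 u)^2 - 3 * V2 u * V4 u) / (V2 u)^6"
    using assms(2) by (simp add: divide_simps)
  finally show ?thesis .
qed

text \<open>By \<open>dA_normalised\<close> the quotient \<open>A^3 / V2^5\<close> does not decrease
  when moving away from \<open>0\<close> in either direction, and at \<open>0\<close> it equals
  \<open>27 * V2 0\<close>. An odd power preserves the sign of \<open>A\<close>.\<close>

lemma A_pos:
  assumes u: "a < u" and pos: "\<And>x. x \<in> closed_segment 0 u \<Longrightarrow> V2 x > 0"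
  shows "A u > 0"
proof -
  let ?f = "\<lambda>u. (A u)^3 / (V2 u)^5"
  let ?D = "\<lambda>x. (A x)^2 * V1 x * (5 * (V3 x)^2 - 3 * V2 x * V4 x) / (V2 x)^6"
  have "?f 0 \<le> ?f u"
  proof (cases "u \<ge> 0")
    case True
    then show ?thesis
    proof (rule DERIV_nonneg_imp_nondecreasing)
      fix x assume x: "0 \<le> x" "x \<le> u"
      have "V2 x > 0" "a < x" using pos x a_neg True by (auto simp: closed_segment_eq_real_ivl)
      moreover have "V1 x \<ge> 0" using V1_pos[of x] V1_0 x by (cases "x = 0") auto
      ultimately have "?D x \<ge> 0" using schaaf[of x] by simp
      then show "\<exists>y. (?f has_real_derivative y) (at x) \<and> 0 \<le> y"
        using dA_normalised \<open>V2 x > 0\<close> \<open>a < x\<close> by blast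
    qed
  next
    case False
    then have "u \<le> 0" by simp
    then show ?thesis
    proof (rule DERIV_nonpos_imp_nonincreasing)
      fix x assume x: "u \<le> x" "x \<le> 0"
      have "V2 x > 0" "a < x" using pos x u False by (auto simp: closed_segment_eq_real_ivl)
      moreover have "V1 x \<le> 0" using V1_neg[of x] V1_0 x \<open>a < x\<close> by (cases "x = 0") auto
      ultimately have "?D x \<le> 0" using schaaf[of x]
        by (intro divide_nonpos_nonneg mult_nonpos_nonneg mult_nonneg_nonpos) auto
      then show "\<exists>y. (?f has_real_derivative y) (at x) \<and> y \<le> 0"
        using dA_normalised \<open>V2 x > 0\<close> \<open>a < x\<close> by blast
    qed
  qed
  moreover have "?f 0 > 0" using V2_0 V1_0 by (simp add: A_def)
  ultimately have "?f u > 0" by simp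
  moreover have "V2 u > 0" using pos by simp
  ultimately have "(A u)^3 > 0" by (simp add: zero_less_divide_iff)
  then show ?thesis by (simp add: zero_less_power_eq)
qed

text \<open>Dividing \<open>2 * V * A - 3 * V1^2 * V2\<close> by \<open>A\<close> leaves
  \<open>V\<close> only in the term \<open>2 * V\<close>, so the derivative no longer contains
  \<open>V\<close> and, under condition (a), has the sign of \<open>V1\<close>. Since the quotient
  vanishes at \<open>0\<close>, positivity of the numerator follows on both sides.\<close>

lemma d_reduced:
  assumes "a < u" "A u > 0"
  shows "((\<lambda>u. 2 * V u - 3 * (V1 u)^2 * V2 u / A u) has_real_derivative
    (V1 u)^3 * (5 * (V3 u)^2 - 3 * V2 u * V4 u) / (A u)^2) (at u)"
proof -
  let ?B = "5 * V2 u * V3 u - V1 u * V4 u"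
  have "((\<lambda>u. 2 * V u - 3 * (V1 u)^2 * V2 u / A u) has_real_derivative
     (2 * V1 u - ((3 * (2 * V1 u * V2 u) * V2 u + 3 * (V1 u)^2 * V3 u) * A u
        - 3 * (V1 u)^2 * V2 u * ?B) / (A u * A u))) (at u)"
    using assms by (auto intro!: derivative_eq_intros dA dV dV1 dV2)
  also have "2 * V1 u - ((3 * (2 * V1 u * V2 u) * V2 u + 3 * (V1 u)^2 * V3 u) * A u
        - 3 * (V1 u)^2 * V2 u * ?B) / (A u * A u)
     = (2 * V1 u * (A u)^2 - ((3 * (2 * V1 u * V2 u) * V2 u + 3 * (V1 u)^2 * V3 u) * A u
        - 3 * (V1 u)^2 * V2 u * ?B)) / (A u)^2"
    using assms(2) by (simp add: diff_divide_distrib power2_eq_square)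
  also have "2 * V1 u * (A u)^2 - ((3 * (2 * V1 u * V2 u) * V2 u + 3 * (V1 u)^2 * V3 u) * A u
        - 3 * (V1 u)^2 * V2 u * ?B) = (V1 u)^3 * (5 * (V3 u)^2 - 3 * V2 u * V4 u)"
    unfolding A_def by algebra
  finally show ?thesis .
qed

text \<open>This is Chicone's numerator: \<open>(V / V1\<^sup>2)'' = (2 V A - 3 V1\<^sup>2 V2) / V1\<^sup>4\<close>.\<close>

lemma chicone_pos:
  assumes u: "a < u" "u \<noteq> 0" and pos: "\<And>x. x \<in> closed_segment 0 u \<Longrightarrow> V2 x > 0"
  shows "2 * V u * A u - 3 * (V1 u)^2 * V2 u > 0"
proof -
  let ?f = "\<lambda>u. 2 * V u - 3 * (V1 u)^2 * V2 u / A u"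
  have Apos: "A x > 0" if "x \<in> closed_segment 0 u" for x
  proof (rule A_pos)
    show "a < x" using that u a_neg by (auto simp: closed_segment_eq_real_ivl split: if_splits)
    show "V2 y > 0" if "y \<in> closed_segment 0 x" for y
      using that \<open>x \<in> closed_segment 0 u\<close> pos[of y] subset_closed_segment[of 0 x 0 u] by auto
  qed
  have der: "(?f has_real_derivative (V1 x)^3 * (5 * (V3 x)^2 - 3 * V2 x * V4 x) / (A x)^2) (at x)"
    if "x \<in> closed_segment 0 u" for x
    using that u a_neg Apos[OF that]
    by (intro d_reduced) (auto simp: closed_segment_eq_real_ivl split: if_splits)
  have "?f 0 < ?f u"
  proof (cases "u > 0")
    case True
    show ?thesis
    proof (rule DERIV_pos_imp_increasing_open[OF True])
      fix x assume x: "0 < x" "x < u"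
      then have s: "x \<in> closed_segment 0 u" by (simp add: closed_segment_eq_real_ivl)
      have "(V1 x)^3 * (5 * (V3 x)^2 - 3 * V2 x * V4 x) / (A x)^2 > 0"
        using Apos[OF s] schaaf[of x] pos[OF s] V1_pos[of x] x a_neg by simp
      with der[OF s] show "\<exists>y. (?f has_real_derivative y) (at x) \<and> 0 < y" by blast
    next
      show "continuous_on {0..u} ?f"
        using der True
        by (intro DERIV_atLeastAtMost_imp_continuous_on) (force simp: closed_segment_eq_real_ivl)
    qed
  next
    case False
    then have "u < 0" using u by simp
    then show ?thesis
    proof (rule DERIV_neg_imp_decreasing_open)
      fix x assume x: "u < x" "x < 0"
      then have s: "x \<in> closed_segment 0 u" by (simp add: closed_segment_eq_real_ivl)
      have "V1 x < 0" using V1_neg[of x] x u by simp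
      then have "(V1 x)^3 < 0" by (simp add: power_less_zero_eq)
      then have "(V1 x)^3 * (5 * (V3 x)^2 - 3 * V2 x * V4 x) / (A x)^2 < 0"
        using Apos[OF s] schaaf[of x] pos[OF s] x u
        by (intro divide_neg_pos mult_neg_pos) auto
      with der[OF s] show "\<exists>y. (?f has_real_derivative y) (at x) \<and> y < 0" by blast
    next
      show "continuous_on {u..0} ?f"
        using der \<open>u < 0\<close>
        by (intro DERIV_atLeastAtMost_imp_continuous_on) (force simp: closed_segment_eq_real_ivl)
    qed
  qed
  then have "?f u > 0" using V_0 V1_0 by simp
  then have "A u * ?f u > 0" using Apos[of u] by simp
  then show ?thesis using Apos[of u] by (simp add: algebra_simps)
qed

lemma dM:
  assumes "a < u" "u \<noteq> 0"
  shows "(M has_real_derivative (2 * V u * A u - 3 * (V1 u)^2 * V2 u) / (V1 u)^4) (at u)"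
proof -
  have nz: "V1 u \<noteq> 0" using assms by (rule V1_nonzero)
  have "(M has_real_derivative
     ((2 * V1 u * V2 u - (2 * V1 u * V2 u + 2 * V u * V3 u)) * (V1 u)^3
       - ((V1 u)^2 - 2 * V u * V2 u) * (3 * (V1 u)^2 * V2 u)) / ((V1 u)^3 * (V1 u)^3)) (at u)"
    unfolding M_def using assms nz by (auto intro!: derivative_eq_intros dV dV1 dV2)
  also have "(2 * V1 u * V2 u - (2 * V1 u * V2 u + 2 * V u * V3 u)) * (V1 u)^3
       - ((V1 u)^2 - 2 * V u * V2 u) * (3 * (V1 u)^2 * V2 u)
     = (V1 u)^2 * (2 * V u * A u - 3 * (V1 u)^2 * V2 u)"
    unfolding A_def by algebra
  also have "(V1 u)^2 * (2 * V u * A u - 3 * (V1 u)^2 * V2 u) / ((V1 u)^3 * (V1 u)^3)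
     = (2 * V u * A u - 3 * (V1 u)^2 * V2 u) / (V1 u)^4"
    using nz by (simp add: divide_simps)
  finally show ?thesis .
qed

lemma M_less_left:
  assumes "a < x" "x < y" "y < 0"
  shows "M x < M y"
proof (rule DERIV_pos_imp_increasing[OF assms(2)])
  fix z assume z: "x \<le> z" "z \<le> y"
  have "2 * V z * A z - 3 * (V1 z)^2 * V2 z > 0"
    using z assms by (intro chicone_pos V2_pos_left) (auto simp: closed_segment_eq_real_ivl)
  then have "(2 * V z * A z - 3 * (V1 z)^2 * V2 z) / (V1 z)^4 > 0"
    using V1_nonzero[of z] z assms by (intro divide_pos_pos) (auto simp: zero_less_power_eq)
  then show "\<exists>D. (M has_real_derivative D) (at z) \<and> 0 < D"
    using dM[of z] z assms by auto
qed

text \<open>Positivity of \<open>V2\<close> is asked only strictly below \<open>y\<close>, so that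
  \<open>y\<close> may be the first inflection point; the sign of the derivative is used only in the
  open interval.\<close>

lemma M_less_right:
  assumes "0 < x" "x < y" and pos: "\<And>z. 0 \<le> z \<Longrightarrow> z < y \<Longrightarrow> V2 z > 0"
  shows "M x < M y"
proof (rule DERIV_pos_imp_increasing_open[OF assms(2)])
  fix z assume z: "x < z" "z < y"
  have "2 * V z * A z - 3 * (V1 z)^2 * V2 z > 0"
    using z assms a_neg by (intro chicone_pos pos) (auto simp: closed_segment_eq_real_ivl)
  then have "(2 * V z * A z - 3 * (V1 z)^2 * V2 z) / (V1 z)^4 > 0"
    using V1_nonzero[of z] z assms a_neg by (intro divide_pos_pos) (auto simp: zero_less_power_eq)
  then show "\<exists>D. (M has_real_derivative D) (at z) \<and> 0 < D"
    using dM[of z] z assms a_neg by auto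
next
  show "continuous_on {x..y} M"
    using dM assms a_neg by (intro DERIV_atLeastAtMost_imp_continuous_on) force
qed

section \<open>The limit of \<open>M\<close> at the centre and the comparison with
  \<open>M0\<close>\<close>

lemma eventually_near_0: "\<forall>\<^sub>F u in at 0. a < u \<and> u \<noteq> 0"
proof -
  have "\<forall>\<^sub>F u in at 0. u \<in> {a<..}"
    using a_neg by (intro eventually_at_in_open') auto
  then show ?thesis using eventually_neq_at_within[of 0 0 UNIV] by eventually_elim auto
qed

lemma tendsto_potential_0:
  "(V \<longlongrightarrow> 0) (at 0)" "(V1 \<longlongrightarrow> 0) (at 0)" "(V2 \<longlongrightarrow> V2 0) (at 0)" "(V3 \<longlongrightarrow> V3 0) (at 0)"
  using isCont_potential[OF a_neg] V_0 V1_0 by (simp_all add: isCont_def)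

lemma eventually_V2_pos: "\<forall>\<^sub>F u in at 0. V2 u > 0"
  using tendsto_potential_0(3) V2_0 by (rule order_tendstoD)

text \<open>One application of l'Hopital, after which \<open>V1\<close> cancels. The limit serves
  twice: for \<open>M\<close> at \<open>0\<close> and for the continuity of \<open>p\<close> at
  \<open>0\<close>.\<close>

lemma tendsto_V_over_V1_sq: "((\<lambda>u. V u / (V1 u)^2) \<longlongrightarrow> 1 / (2 * V2 0)) (at 0)"
proof (rule lhopital[where f' = V1 and g' = "\<lambda>u. 2 * V1 u * V2 u"])
  show "((\<lambda>u. (V1 u)^2) \<longlongrightarrow> 0) (at 0)"
    using tendsto_power[OF tendsto_potential_0(2), of 2] by simp
  show "\<forall>\<^sub>F u in at 0. (V1 u)^2 \<noteq> 0"
    using eventually_near_0 by eventually_elim (auto simp: V1_nonzero)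
  show "\<forall>\<^sub>F u in at 0. 2 * V1 u * V2 u \<noteq> 0"
    using eventually_near_0 eventually_V2_pos by eventually_elim (auto simp: V1_nonzero)
  show "\<forall>\<^sub>F u in at 0. (V has_real_derivative V1 u) (at u)"
    using eventually_near_0 by eventually_elim (auto simp: dV)
  show "\<forall>\<^sub>F u in at 0. ((\<lambda>u. (V1 u)^2) has_real_derivative 2 * V1 u * V2 u) (at u)"
    using eventually_near_0 by eventually_elim (auto intro!: derivative_eq_intros dV1)
  have "((\<lambda>u. 1 / (2 * V2 u)) \<longlongrightarrow> 1 / (2 * V2 0)) (at 0)"
    using V2_0 by (auto intro!: tendsto_intros tendsto_potential_0)
  then show "((\<lambda>u. V1 u / (2 * V1 u * V2 u)) \<longlongrightarrow> 1 / (2 * V2 0)) (at 0)"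
    by (rule Lim_transform_eventually)
       (use eventually_near_0 in \<open>eventually_elim; auto simp: V1_nonzero\<close>)
qed (rule tendsto_potential_0)

text \<open>The derivative of the numerator collapses to \<open>- 2 * V * V3\<close>, so after one
  l'Hopital step the quotient is \<open>V / V1^2\<close> times a function continuous at
  \<open>0\<close>.\<close>

lemma tendsto_M_0: "(M \<longlongrightarrow> M0) (at 0)"
  unfolding M_def
proof (rule lhopital[where f' = "\<lambda>u. - 2 * V u * V3 u" and g' = "\<lambda>u. 3 * (V1 u)^2 * V2 u"])
  show "((\<lambda>u. (V1 u)^2 - 2 * V u * V2 u) \<longlongrightarrow> 0) (at 0)"
    by (auto intro!: tendsto_eq_intros tendsto_potential_0)
  show "((\<lambda>u. (V1 u)^3) \<longlongrightarrow> 0) (at 0)"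
    by (auto intro!: tendsto_eq_intros tendsto_potential_0)
  show "\<forall>\<^sub>F u in at 0. (V1 u)^3 \<noteq> 0"
    using eventually_near_0 by eventually_elim (auto simp: V1_nonzero)
  show "\<forall>\<^sub>F u in at 0. 3 * (V1 u)^2 * V2 u \<noteq> 0"
    using eventually_near_0 eventually_V2_pos by eventually_elim (auto simp: V1_nonzero)
  show "\<forall>\<^sub>F u in at 0. ((\<lambda>u. (V1 u)^2 - 2 * V u * V2 u) has_real_derivative - 2 * V u * V3 u) (at u)"
    using eventually_near_0 by eventually_elim (auto intro!: derivative_eq_intros dV dV1 dV2)
  show "\<forall>\<^sub>F u in at 0. ((\<lambda>u. (V1 u)^3) has_real_derivative 3 * (V1 u)^2 * V2 u) (at u)"
    using eventually_near_0 by eventually_elim (auto intro!: derivative_eq_intros dV1)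
  have "((\<lambda>u. V u / (V1 u)^2 * (- 2 * V3 u / (3 * V2 u))) \<longlongrightarrow> 1 / (2 * V2 0) * (- 2 * V3 0 / (3 * V2 0))) (at 0)"
    using V2_0 by (intro tendsto_intros tendsto_potential_0 tendsto_V_over_V1_sq) auto
  also have "1 / (2 * V2 0) * (- 2 * V3 0 / (3 * V2 0)) = M0"
    by (simp add: M0_def power2_eq_square)
  finally show "((\<lambda>u. - 2 * V u * V3 u / (3 * (V1 u)^2 * V2 u)) \<longlongrightarrow> M0) (at 0)"
    by (simp add: mult.assoc mult.commute mult.left_commute)
qed

lemma M_less_M0:
  assumes "a < u" "u < 0"
  shows "M u < M0"
proof -
  obtain w where w: "u < w" "w < 0" using assms dense by blast
  have "M w \<le> M0"
  proof (rule tendsto_lowerbound)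
    show "(M \<longlongrightarrow> M0) (at_left 0)"
      using tendsto_M_0 by (rule filterlim_mono) (auto simp: at_le)
    show "\<forall>\<^sub>F x in at_left 0. M w \<le> M x"
      using eventually_at_left_real[OF w(2)]
      by eventually_elim (use M_less_left[of w] w assms in \<open>auto intro: less_imp_le\<close>)
  qed simp
  then show ?thesis using M_less_left[of u w] w assms by simp
qed

text \<open>\<open>M\<close> is increasing on the left and there \<open>M x \<ge> 1 / V1 x\<close>,
  because \<open>V2 > 0\<close> and \<open>V1 < 0\<close>. As \<open>V1\<close> tends to minus
  infinity at \<open>a\<close>, the lower bound tends to \<open>0\<close>.\<close>

lemma M_nonneg_left:
  assumes "a < u" "u < 0"
  shows "M u \<ge> 0"
proof (rule tendsto_upperbound)
  show "((\<lambda>x. inverse (V1 x)) \<longlongrightarrow> 0) (at_right a)"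
    by (rule filterlim_compose[OF tendsto_inverse_0 filterlim_at_bot_imp_at_infinity[OF lim_V1]])
  show "\<forall>\<^sub>F x in at_right a. inverse (V1 x) \<le> M u"
    using eventually_at_right_real[OF assms(1)]
  proof eventually_elim
    case (elim x)
    then have x: "a < x" "x < u" by auto
    have neg: "V1 x < 0" using V1_neg[of x] x assms by simp
    have "M x = inverse (V1 x) + (- (2 * V x * V2 x)) / (V1 x)^3"
      using neg by (simp add: M_def divide_simps) algebra
    moreover have "(- (2 * V x * V2 x)) / (V1 x)^3 \<ge> 0"
      using neg V_pos[of x] V2_pos_left[of x] x assms
      by (intro divide_nonpos_neg) (auto simp: power_less_zero_eq)
    ultimately show ?case using M_less_left[of x u] x assms by simp
  qed
qed simp

lemma M0_pos: "M0 > 0"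
  using M_nonneg_left[of "a/2"] M_less_M0[of "a/2"] a_neg by simp

lemma M0_less_M_convex:
  assumes "0 < u" and pos: "\<And>z. 0 \<le> z \<Longrightarrow> z < u \<Longrightarrow> V2 z > 0"
  shows "M0 < M u"
proof -
  have "M0 \<le> M (u/2)"
  proof (rule tendsto_upperbound)
    show "(M \<longlongrightarrow> M0) (at_right 0)"
      using tendsto_M_0 by (rule filterlim_mono) (auto simp: at_le)
    have "0 < u/2" using assms by simp
    from eventually_at_right_real[OF this] show "\<forall>\<^sub>F x in at_right 0. M x \<le> M (u/2)"
      by eventually_elim (use M_less_right[of _ "u/2"] pos in \<open>auto intro: less_imp_le\<close>)
  qed simp
  also have "\<dots> < M u" using assms by (intro M_less_right) auto
  finally show ?thesis .
qed

text \<open>Beyond the first inflection point \<open>b\<close>, \<open>V2\<close> stays nonpositive, whence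
  \<open>M u \<ge> 1 / V1 u \<ge> 1 / V1 b = M b\<close>.\<close>

lemma M0_less_M:
  assumes "0 < u"
  shows "M0 < M u"
proof (cases "\<forall>z. 0 \<le> z \<and> z < u \<longrightarrow> V2 z > 0")
  case True
  then show ?thesis using M0_less_M_convex[OF assms] by blast
next
  case False
  then obtain z where z: "0 \<le> z" "z < u" "V2 z \<le> 0" by (auto simp: not_less)
  have "0 < z" using z V2_0 by (cases "z = 0") auto
  moreover have "continuous_on {0..z} V2"
    using a_neg by (auto intro!: continuous_at_imp_continuous_on isCont_potential)
  ultimately obtain b where b: "0 < b" "b \<le> z" "V2 b = 0" "\<And>x. 0 \<le> x \<Longrightarrow> x < b \<Longrightarrow> V2 x > 0"
    using first_zero[of 0 z V2] V2_0 z by auto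
  have V2_nonpos: "V2 x \<le> 0" if "b \<le> x" for x
  proof (rule nonpos_after_downcrossing[where f = V2 and f' = V3, OF that])
    fix y assume y: "b \<le> y"
    show "(V2 has_real_derivative V3 y) (at y)" using dV2 y b a_neg by auto
    assume "V2 y = 0"
    then show "V3 y < 0"
      using inflection[of y] V1_pos[of y] y b a_neg by (auto simp: mult_less_0_iff)
  qed (use b in auto)
  have "M0 < M b" using b by (intro M0_less_M_convex) auto
  also have "M b = 1 / V1 b" using b V1_pos[of b] by (simp add: M_def power2_eq_square power3_eq_cube)
  also have "\<dots> \<le> 1 / V1 u"
  proof -
    have "V1 u \<le> V1 b"
    proof (rule DERIV_nonpos_imp_nonincreasing[of b u V1])
      show "b \<le> u" using b z by simp
      show "\<exists>y. (V1 has_real_derivative y) (at x) \<and> y \<le> 0" if "b \<le> x" "x \<le> u" for x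
        using dV1[of x] V2_nonpos[of x] that b a_neg by force
    qed
    then show ?thesis using V1_pos[of u] assms by (simp add: frac_le)
  qed
  also have "1 / V1 u \<le> M u"
  proof -
    have pos: "V1 u > 0" "V u > 0" using V1_pos V_pos assms a_neg by auto
    then have "M u = 1 / V1 u + (2 * V u * (- V2 u)) / (V1 u)^3"
      by (simp add: M_def divide_simps) algebra
    moreover have "(2 * V u * (- V2 u)) / (V1 u)^3 \<ge> 0"
      using pos V2_nonpos[of u] b z by (intro divide_nonneg_pos mult_nonneg_nonneg) auto
    ultimately show ?thesis by simp
  qed
  finally show ?thesis .
qed

section \<open>The coordinate \<open>\<sigma>\<close>, its inverse \<open>\<phi>\<close> and the
  derivative \<open>p\<close>\<close>

definition \<sigma> :: "real \<Rightarrow> real" where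
  "\<sigma> u = sgn u * sqrt (V u)"

text \<open>The value \<open>a\<close> below \<open>- sqrt hs\<close> makes
  \<open>\<phi> (- sqrt h)\<close> the lower limit of integration in both regimes of
  \<open>h\<close>.\<close>

definition \<phi> :: "real \<Rightarrow> real" where
  "\<phi> r = (if r \<le> - sqrt hs then a else THE u. a < u \<and> \<sigma> u = r)"

text \<open>The derivative of \<open>\<phi>\<close>: differentiating
  \<open>V (\<phi> r) = r^2\<close> gives \<open>2 * r / V1 (\<phi> r)\<close>. At \<open>0\<close>,
  where this is \<open>0 / 0\<close>, the limit is inserted; on the constant part the value is
  zero.\<close>

definition p :: "real \<Rightarrow> real" where
  "p r = (if r \<le> - sqrt hs then 0 else if r = 0 then 2 * sqrt (1 / (2 * V2 0)) else 2 * r / V1 (\<phi> r))"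

lemma sqrt_hs_pos: "sqrt hs > 0"
  using hs_pos by simp

lemma continuous_V: "a < x \<Longrightarrow> continuous_on {x..y} V"
  by (auto intro!: continuous_at_imp_continuous_on isCont_potential)

lemma \<sigma>_0 [simp]: "\<sigma> 0 = 0"
  by (simp add: \<sigma>_def)

lemma \<sigma>_sq: "a < u \<Longrightarrow> (\<sigma> u)^2 = V u"
  using V_pos[of u] V_0 by (cases "u = 0") (auto simp: \<sigma>_def power_mult_distrib sgn_if)

lemma \<sigma>_less:
  assumes "a < x" "x < y"
  shows "\<sigma> x < \<sigma> y"
proof -
  consider "0 \<le> x" | "x < 0" "0 < y" | "x < 0" "y = 0" | "y < 0" using assms by linarith
  then show ?thesis
  proof cases
    case 1
    then show ?thesis using V_less[of x y] V_0 assms by (cases "x = 0") (auto simp: \<sigma>_def)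
  next
    case 2
    then have "- sqrt (V x) < 0" "0 < sqrt (V y)" using V_pos[of x] V_pos[of y] assms by auto
    then have "- sqrt (V x) < sqrt (V y)" by linarith
    then show ?thesis using 2 by (simp add: \<sigma>_def)
  next
    case 3
    then show ?thesis using V_pos[of x] assms by (simp add: \<sigma>_def)
  next
    case 4
    then show ?thesis using V_greater[of x y] assms by (simp add: \<sigma>_def)
  qed
qed

lemma \<sigma>_gt: "a < u \<Longrightarrow> \<sigma> u > - sqrt hs"
  using V_less_hs[of u] V_pos[of u] sqrt_hs_pos
  by (cases u "0::real" rule: linorder_cases) (auto simp: \<sigma>_def intro: less_trans[of _ 0])

text \<open>Intermediate values of \<open>V\<close> at height \<open>r^2\<close>: the right branch
  reaches it since \<open>V\<close> is unbounded, the left branch since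
  \<open>r^2 < hs\<close>.\<close>

lemma \<sigma>_surj:
  assumes "r > - sqrt hs"
  obtains u where "a < u" "\<sigma> u = r"
proof (cases r "0::real" rule: linorder_cases)
  case equal
  then show ?thesis using that[of 0] a_neg by simp
next
  case greater
  have "\<forall>\<^sub>F w in at_top. V w \<ge> r^2" using V_inf by (simp add: filterlim_at_top)
  then have "\<forall>\<^sub>F w in at_top. V w \<ge> r^2 \<and> w > 0"
    using eventually_gt_at_top[of 0] by eventually_elim auto
  then obtain w where w: "V w \<ge> r^2" "w > 0"
    using eventually_happens'[OF trivial_limit_at_top_linorder] by blast
  then obtain u where u: "0 \<le> u" "u \<le> w" "V u = r^2"
    using IVT'[of V 0 "r^2" w] V_0 a_neg continuous_V[of 0 w] by auto
  then have "u > 0" using V_0 greater by (cases "u = 0") auto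
  then show ?thesis using that[of u] u greater a_neg by (simp add: \<sigma>_def)
next
  case less
  have "r^2 < hs"
    using assms less hs_pos power_strict_mono[of "- r" "sqrt hs" 2] by simp
  then have "\<forall>\<^sub>F w in at_right a. V w > r^2"
    by (rule order_tendstoD(1)[OF lim_V])
  then have "\<forall>\<^sub>F w in at_right a. V w > r^2 \<and> a < w \<and> w < 0"
    using eventually_at_right_real[OF a_neg] by eventually_elim auto
  then obtain w where w: "V w > r^2" "a < w" "w < 0"
    using eventually_happens'[OF trivial_limit_at_right_real] by blast
  then obtain u where u: "w \<le> u" "u \<le> 0" "V u = r^2"
    using IVT2'[of V 0 "r^2" w] V_0 a_neg continuous_V[of w 0] by auto
  then have "u < 0" using V_0 less by (cases "u = 0") auto
  then show ?thesis using that[of u] u w less by (simp add: \<sigma>_def)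
qed

lemma \<sigma>_eq_iff: "a < x \<Longrightarrow> a < y \<Longrightarrow> \<sigma> x = \<sigma> y \<longleftrightarrow> x = y"
  using \<sigma>_less[of x y] \<sigma>_less[of y x] by (cases x y rule: linorder_cases) auto

lemma \<sigma>_less_iff: "a < x \<Longrightarrow> a < y \<Longrightarrow> \<sigma> x < \<sigma> y \<longleftrightarrow> x < y"
  using \<sigma>_less[of x y] \<sigma>_less[of y x] by (cases x y rule: linorder_cases) auto

lemma \<phi>_\<sigma> [simp]:
  assumes "a < u"
  shows "\<phi> (\<sigma> u) = u"
proof -
  have "(THE w. a < w \<and> \<sigma> w = \<sigma> u) = u"
    using assms \<sigma>_eq_iff by (intro the_equality) auto
  then show ?thesis using \<sigma>_gt[OF assms] by (simp add: \<phi>_def)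
qed

lemma \<phi>_inverse:
  assumes "r > - sqrt hs"
  shows "a < \<phi> r" "\<sigma> (\<phi> r) = r"
proof -
  obtain u where "a < u" "\<sigma> u = r" using \<sigma>_surj[OF assms] .
  then show "a < \<phi> r" "\<sigma> (\<phi> r) = r" by auto
qed

lemma \<phi>_less_iff: "r > - sqrt hs \<Longrightarrow> s > - sqrt hs \<Longrightarrow> \<phi> r < \<phi> s \<longleftrightarrow> r < s"
  using \<sigma>_less_iff[of "\<phi> r" "\<phi> s"] \<phi>_inverse by auto

lemma \<phi>_0 [simp]: "\<phi> 0 = 0"
  using \<phi>_\<sigma>[of 0] a_neg by simp

lemma \<phi>_pos: "r > 0 \<Longrightarrow> \<phi> r > 0"
  using \<phi>_less_iff[of 0 r] sqrt_hs_pos by simp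

lemma \<phi>_neg: "r > - sqrt hs \<Longrightarrow> r < 0 \<Longrightarrow> \<phi> r < 0"
  using \<phi>_less_iff[of r 0] hs_pos by auto

lemma \<phi>_nonzero: "r > - sqrt hs \<Longrightarrow> r \<noteq> 0 \<Longrightarrow> \<phi> r \<noteq> 0"
  using \<phi>_pos[of r] \<phi>_neg[of r] by (cases "r > 0") auto

lemma V_\<phi>: "r > - sqrt hs \<Longrightarrow> V (\<phi> r) = r^2"
  using \<sigma>_sq \<phi>_inverse by metis

lemma d\<sigma>:
  assumes "a < u" "u \<noteq> 0"
  shows "(\<sigma> has_real_derivative V1 u / (2 * \<sigma> u)) (at u)"
proof -
  have "((\<lambda>x. sgn u * sqrt (V x)) has_real_derivative V1 u / (2 * \<sigma> u)) (at u)"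
    using assms V_pos[OF assms] dV[OF assms(1)]
    by (auto intro!: derivative_eq_intros simp: \<sigma>_def field_simps sgn_if)
  then show ?thesis
  proof (rule has_field_derivative_transform_within_open)
    show "open (if u > 0 then {0<..} else {..<0::real})" "u \<in> (if u > 0 then {0<..} else {..<0})"
      using assms by auto
    show "sgn u * sqrt (V x) = \<sigma> x" if "x \<in> (if u > 0 then {0<..} else {..<0})" for x
      using that assms by (auto simp: \<sigma>_def sgn_if split: if_splits)
  qed
qed

lemma isCont_\<sigma>:
  assumes "a < u"
  shows "isCont \<sigma> u"
proof (cases "u = 0")
  case False
  then show ?thesis using d\<sigma>[OF assms] DERIV_isCont by blast
next
  case True
  \<comment> \<open>The chain rule fails here because \<open>sqrt\<close> is not differentiable at
    \<open>0\<close>; a squeeze by \<open>sqrt (V x)\<close> is used instead.\<close>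
  have "((\<lambda>x. sqrt (V x)) \<longlongrightarrow> 0) (at 0)"
    using tendsto_real_sqrt[OF tendsto_potential_0(1)] by simp
  moreover have "\<forall>\<^sub>F x in at 0. norm (\<sigma> x) \<le> sqrt (V x)"
    using eventually_near_0
    by eventually_elim (use V_pos in \<open>auto simp: \<sigma>_def abs_mult less_imp_le\<close>)
  ultimately have "(\<sigma> \<longlongrightarrow> 0) (at 0)" by (rule Lim_null_comparison[rotated])
  then show ?thesis using True by (simp add: isCont_def)
qed

lemma isCont_\<phi>:
  assumes "r > - sqrt hs"
  shows "isCont \<phi> r"
proof -
  have r: "a < \<phi> r" "\<sigma> (\<phi> r) = r" using \<phi>_inverse[OF assms] by auto
  obtain l where l: "a < l" "l < \<phi> r" using r dense by blast
  have "isCont \<phi> (\<sigma> (\<phi> r))"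
    by (rule isCont_inverse_function2[where a = l and b = "\<phi> r + 1"])
       (use l in \<open>auto intro: isCont_\<sigma>\<close>)
  then show ?thesis using r by simp
qed

lemma d\<phi>:
  assumes "r > - sqrt hs" "r \<noteq> 0"
  shows "(\<phi> has_real_derivative p r) (at r)"
proof -
  have "(\<phi> has_real_derivative inverse (V1 (\<phi> r) / (2 * \<sigma> (\<phi> r)))) (at r)"
  proof (rule DERIV_inverse_function[where a = "- sqrt hs" and b = "r + 1"])
    show "(\<sigma> has_real_derivative V1 (\<phi> r) / (2 * \<sigma> (\<phi> r))) (at (\<phi> r))"
      using \<phi>_inverse[OF assms(1)] \<phi>_nonzero[OF assms] by (intro d\<sigma>) auto
    show "V1 (\<phi> r) / (2 * \<sigma> (\<phi> r)) \<noteq> 0"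
      using V1_nonzero \<phi>_inverse[OF assms(1)] \<phi>_nonzero[OF assms] assms by auto
  qed (use assms \<phi>_inverse isCont_\<phi> in auto)
  then show ?thesis using assms \<phi>_inverse[OF assms(1)] by (simp add: p_def)
qed

text \<open>The quotient rule for \<open>2 * r / V1 (\<phi> r)\<close>, with \<open>r^2\<close>
  replaced by \<open>V (\<phi> r)\<close>, produces exactly \<open>2 * M\<close>.\<close>

lemma dp:
  assumes "r > - sqrt hs" "r \<noteq> 0"
  shows "(p has_real_derivative 2 * M (\<phi> r)) (at r)"
proof -
  let ?v = "V1 (\<phi> r)"
  have nz: "?v \<noteq> 0" using V1_nonzero \<phi>_inverse[OF assms(1)] \<phi>_nonzero[OF assms] by auto
  have "((\<lambda>r. V1 (\<phi> r)) has_real_derivative V2 (\<phi> r) * p r) (at r)"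
    using d\<phi>[OF assms] dV1 \<phi>_inverse[OF assms(1)] by (intro DERIV_chain2) auto
  then have "((\<lambda>r. 2 * r / V1 (\<phi> r)) has_real_derivative
      (2 * ?v - 2 * r * (V2 (\<phi> r) * p r)) / (?v * ?v)) (at r)"
    using nz by (auto intro!: derivative_eq_intros)
  also have "(2 * ?v - 2 * r * (V2 (\<phi> r) * p r)) / (?v * ?v) = 2 * M (\<phi> r)"
    using nz assms by (simp add: M_def p_def V_\<phi> divide_simps) algebra
  finally show ?thesis
  proof (rule has_field_derivative_transform_within_open)
    show "open ({- sqrt hs<..} - {0})" by (intro open_Diff) auto
    show "r \<in> {- sqrt hs<..} - {0}" using assms by simp
    show "2 * x / V1 (\<phi> x) = p x" if "x \<in> {- sqrt hs<..} - {0}" for x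
      using that by (simp add: p_def)
  qed
qed

lemma dp_left:
  assumes "r < - sqrt hs"
  shows "(p has_real_derivative 0) (at r)"
proof (rule has_field_derivative_transform_within_open[of "\<lambda>_. 0"])
  show "open {..< - sqrt hs}" "r \<in> {..< - sqrt hs}" using assms by auto
qed (auto simp: p_def)

text \<open>Allows the blow-up of \<open>V1\<close> at \<open>a\<close> to be composed with
  \<open>\<phi>\<close>.\<close>

lemma filterlim_\<phi>_a: "filterlim \<phi> (at_right a) (at_right (- sqrt hs))"
proof -
  have ev: "\<forall>\<^sub>F r in at_right (- sqrt hs). a < \<phi> r \<and> \<phi> r < c" if "a < c" for c
  proof -
    have "- sqrt hs < \<sigma> c" using \<sigma>_gt that by simp
    from eventually_at_right_real[OF this] show ?thesis
    proof eventually_elim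
      case (elim r)
      then have "\<sigma> (\<phi> r) < \<sigma> c" "a < \<phi> r" using \<phi>_inverse[of r] by auto
      then show ?case using \<sigma>_less_iff[of "\<phi> r" c] that by simp
    qed
  qed
  have "(\<phi> \<longlongrightarrow> a) (at_right (- sqrt hs))"
  proof (rule order_tendstoI)
    show "\<forall>\<^sub>F r in at_right (- sqrt hs). c < \<phi> r" if "c < a" for c
      using ev[OF a_neg] by eventually_elim (use that in auto)
    show "\<forall>\<^sub>F r in at_right (- sqrt hs). \<phi> r < c" if "a < c" for c
      using ev[OF that] by eventually_elim auto
  qed
  moreover have "\<forall>\<^sub>F r in at_right (- sqrt hs). \<phi> r \<in> {a<..} \<and> \<phi> r \<noteq> a"
    using ev[OF a_neg] by eventually_elim auto
  ultimately show ?thesis by (simp add: filterlim_at)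
qed

text \<open>Since \<open>r\<close> and \<open>V1 (\<phi> r)\<close> have the same sign,
  \<open>p r\<close> is twice the positive root of \<open>V / V1^2\<close> at
  \<open>\<phi> r\<close>, whose limit is known.\<close>

lemma isCont_p_0: "isCont p 0"
proof -
  have ev: "\<forall>\<^sub>F r in at 0. r \<in> {- sqrt hs<..} - {0}"
    using hs_pos eventually_at_in_open[of "{- sqrt hs<..}" 0] by auto
  have "(\<phi> \<longlongrightarrow> 0) (at 0)" using isCont_\<phi>[of 0] hs_pos by (simp add: isCont_def)
  then have "filterlim \<phi> (at 0) (at 0)"
    unfolding filterlim_at using ev by (auto elim!: eventually_mono simp: \<phi>_nonzero)
  then have "((\<lambda>r. V (\<phi> r) / (V1 (\<phi> r))^2) \<longlongrightarrow> 1 / (2 * V2 0)) (at 0)"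
    by (rule filterlim_compose[OF tendsto_V_over_V1_sq])
  then have "((\<lambda>r. 2 * sqrt (V (\<phi> r) / (V1 (\<phi> r))^2)) \<longlongrightarrow> 2 * sqrt (1 / (2 * V2 0))) (at 0)"
    by (intro tendsto_mult tendsto_const tendsto_real_sqrt)
  moreover have "\<forall>\<^sub>F r in at 0. 2 * sqrt (V (\<phi> r) / (V1 (\<phi> r))^2) = p r"
    using ev
  proof eventually_elim
    case (elim r)
    then have "r * V1 (\<phi> r) > 0"
      using V1_pos[OF \<phi>_pos, of r] V1_neg[OF \<phi>_inverse(1) \<phi>_neg, of r]
      by (cases "r > 0") (auto simp: mult_neg_neg)
    then have "r / V1 (\<phi> r) > 0" by (simp add: zero_less_divide_iff zero_less_mult_iff)
    moreover have "V (\<phi> r) / (V1 (\<phi> r))^2 = (r / V1 (\<phi> r))^2"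
      using elim by (simp add: V_\<phi> power_divide)
    ultimately have "sqrt (V (\<phi> r) / (V1 (\<phi> r))^2) = r / V1 (\<phi> r)"
      by (simp only: real_sqrt_abs abs_of_pos)
    then show ?case using elim by (simp add: p_def)
  qed
  ultimately have "(p \<longlongrightarrow> 2 * sqrt (1 / (2 * V2 0))) (at 0)" by (rule Lim_transform_eventually)
  then show ?thesis using hs_pos by (simp add: isCont_def p_def)
qed

text \<open>Here the two regimes are glued: \<open>V1\<close> tends to minus infinity at
  \<open>a\<close>, so \<open>p\<close> tends to \<open>0\<close> from the right and matches its
  zero values on the left.\<close>

lemma isCont_p_escape: "isCont p (- sqrt hs)"
proof -
  have "((\<lambda>r. inverse (V1 (\<phi> r))) \<longlongrightarrow> 0) (at_right (- sqrt hs))"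
    by (rule filterlim_compose[OF tendsto_inverse_0
        filterlim_at_bot_imp_at_infinity[OF filterlim_compose[OF lim_V1 filterlim_\<phi>_a]]])
  then have "((\<lambda>r. 2 * r * inverse (V1 (\<phi> r))) \<longlongrightarrow> 2 * (- sqrt hs) * 0) (at_right (- sqrt hs))"
    by (intro tendsto_intros)
  moreover have "- sqrt hs < 0" using hs_pos by simp
  from eventually_at_right_real[OF this]
  have "\<forall>\<^sub>F r in at_right (- sqrt hs). 2 * r * inverse (V1 (\<phi> r)) = p r"
    by eventually_elim (auto simp: p_def divide_inverse)
  ultimately have "(p \<longlongrightarrow> 2 * (- sqrt hs) * 0) (at_right (- sqrt hs))"
    by (rule Lim_transform_eventually)
  then have "(p \<longlongrightarrow> 0) (at_right (- sqrt hs))" by simp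
  moreover have "\<forall>\<^sub>F r in at_left (- sqrt hs). 0 = p r"
    unfolding eventually_at_filter by (rule always_eventually) (simp add: p_def)
  then have "(p \<longlongrightarrow> 0) (at_left (- sqrt hs))"
    by (rule Lim_transform_eventually[OF tendsto_const])
  ultimately have "(p \<longlongrightarrow> 0) (at (- sqrt hs))" by (rule filterlim_split_at[rotated])
  then show ?thesis by (simp add: isCont_def p_def)
qed

lemma continuous_p: "continuous_on S p"
proof (rule continuous_at_imp_continuous_on, rule ballI)
  fix r
  show "isCont p r"
    using isCont_p_0 isCont_p_escape dp[of r] dp_left[of r] DERIV_isCont
    by (cases "r = 0"; cases r "- sqrt hs" rule: linorder_cases) auto
qed

section \<open>Both branches of the period as one angular average\<close>

text \<open>Describes the image of the substitution for all \<open>h\<close> at once. The point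
  \<open>0\<close> is removed because the derivative of \<open>\<phi>\<close> is available only away
  from it.\<close>

lemma level_set_eq:
  assumes h: "h > 0"
  shows "{x. a < x \<and> x \<noteq> 0 \<and> V x < h} = {\<phi> (- sqrt h)<..<\<phi> (sqrt h)} - {0}"
proof -
  have sq: "V x < h \<longleftrightarrow> - sqrt h < \<sigma> x \<and> \<sigma> x < sqrt h" if "a < x" for x
  proof -
    have "V x < h \<longleftrightarrow> \<bar>\<sigma> x\<bar> < sqrt h"
      using \<sigma>_sq[OF that] real_sqrt_abs[of "\<sigma> x"] real_sqrt_less_iff[of "V x" h] by simp
    then show ?thesis by auto
  qed
  have up: "\<sigma> x < sqrt h \<longleftrightarrow> x < \<phi> (sqrt h)" if "a < x" for x
  proof -
    have "- sqrt hs < sqrt h" using real_sqrt_gt_zero[OF h] sqrt_hs_pos by linarith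
    from \<phi>_inverse[OF this] show ?thesis using \<sigma>_less_iff[OF that] by metis
  qed
  have low: "a < x \<and> - sqrt h < \<sigma> x \<longleftrightarrow> \<phi> (- sqrt h) < x" for x
  proof (cases "h < hs")
    case True
    then have "- sqrt hs < - sqrt h" by simp
    note inv = \<phi>_inverse[OF this]
    then show ?thesis using \<sigma>_less_iff[of "\<phi> (- sqrt h)" x] by auto
  next
    case False
    then have "\<phi> (- sqrt h) = a" by (simp add: \<phi>_def)
    moreover have "- sqrt h < \<sigma> x" if "a < x"
      using \<sigma>_gt[OF that] False real_sqrt_le_mono[of hs h] by linarith
    ultimately show ?thesis by auto
  qed
  have "a < x \<and> x \<noteq> 0 \<and> V x < h \<longleftrightarrow> (\<phi> (- sqrt h) < x \<and> x < \<phi> (sqrt h)) \<and> x \<noteq> 0" for x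
    using sq[of x] up[of x] low[of x] by blast
  then show ?thesis
    unfolding set_eq_iff mem_Collect_eq Diff_iff greaterThanLessThan_iff singleton_iff by blast
qed

text \<open>With \<open>u = \<phi> (sqrt h * sin t)\<close> one has
  \<open>sqrt (h - V u) = sqrt h * cos t\<close>, which cancels the inner derivative and leaves
  \<open>p\<close>.\<close>

lemma period_as_angular_average:
  assumes h: "h > 0"
  shows "integral {\<phi> (- sqrt h)..\<phi> (sqrt h)} (\<lambda>u. 1 / sqrt (h - V u))
    = integral {-pi/2..pi/2} (\<lambda>t. p (sqrt h * sin t))"
proof -
  let ?f = "\<lambda>u. 1 / sqrt (h - V u)"
  \<comment> \<open>The angles at which the substitution is injective and differentiable; for
    \<open>h > hs\<close> those mapped below \<open>- sqrt hs\<close>, where \<open>\<phi>\<close>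
    is constant, are cut off.\<close>
  define S where "S = {-pi/2<..<pi/2} \<inter> - {0} \<inter> {t. - sqrt hs < sqrt h * sin t}"
  define g where "g = (\<lambda>t. \<phi> (sqrt h * sin t))"
  define g' where "g' = (\<lambda>t. p (sqrt h * sin t) * (sqrt h * cos t))"
  let ?L = "{x. a < x \<and> x \<noteq> 0 \<and> V x < h}"
  have "open S"
    unfolding S_def by (intro open_Int open_Collect_less) (auto intro!: continuous_intros)
  then have Sm: "S \<in> sets lebesgue" by (metis borel_open sets_completionI_sets sets_lborel)
  have r: "- sqrt hs < sqrt h * sin t" "sqrt h * sin t \<noteq> 0" "cos t > 0" if "t \<in> S" for t
  proof -
    show "- sqrt hs < sqrt h * sin t" using that by (simp add: S_def)
    show "cos t > 0" using that by (intro cos_gt_zero_pi) (auto simp: S_def)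
    have "sin t \<noteq> sin 0" using that sin_inj_pi[of t 0] by (auto simp: S_def)
    then show "sqrt h * sin t \<noteq> 0" using h by simp
  qed
  have der: "(g has_field_derivative g' t) (at t within S)" if "t \<in> S" for t
    unfolding g_def g'_def
    by (rule has_field_derivative_at_within, rule DERIV_chain2[where f = \<phi> and g = "\<lambda>t. sqrt h * sin t"])
       (use r[OF that] in \<open>auto intro!: derivative_eq_intros d\<phi>\<close>)
  have inj: "inj_on g S"
  proof (rule inj_onI)
    fix x y assume xy: "x \<in> S" "y \<in> S" "g x = g y"
    then have "sqrt h * sin x = sqrt h * sin y"
      using \<phi>_inverse(2)[OF r(1)] unfolding g_def by metis
    then have "sin x = sin y" using h by simp
    then show "x = y" by (rule sin_inj_pi[rotated 4]) (use xy in \<open>auto simp: S_def\<close>)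
  qed
  have img: "g ` S = ?L"
  proof (intro equalityI subsetI)
    fix x assume "x \<in> g ` S"
    then obtain t where t: "t \<in> S" "x = g t" by auto
    have "(sin t)^2 < 1" using r(3)[OF t(1)] sin_cos_squared_add[of t] zero_less_power[of "cos t" 2] by linarith
    then have "V x < h" using V_\<phi>[OF r(1)[OF t(1)]] h t by (simp add: g_def power_mult_distrib)
    then show "x \<in> ?L"
      using t r[OF t(1)] \<phi>_inverse(1) \<phi>_nonzero by (auto simp: g_def)
  next
    fix x assume x: "x \<in> ?L"
    define s where "s = \<sigma> x / sqrt h"
    have "s^2 < 1" using \<sigma>_sq[of x] x h by (simp add: s_def power_divide)
    then have s: "-1 < s" "s < 1" using abs_square_less_1[of s] by auto
    have sx: "sqrt h * s = \<sigma> x" using h by (simp add: s_def)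
    have "\<sigma> x \<noteq> \<sigma> 0" using \<sigma>_eq_iff[of x 0] x a_neg by blast
    then have "s \<noteq> 0" using sx by auto
    then have "arcsin s \<in> S"
      using s arcsin_lt_bounded[OF s] \<sigma>_gt[of x] x sx by (auto simp: S_def arcsin_eq_iff[of _ 0, simplified])
    moreover have "g (arcsin s) = x" using s sx x by (simp add: g_def)
    ultimately show "x \<in> g ` S" by (metis imageI)
  qed
  have integrand: "\<bar>g' t\<bar> * ?f (g t) = p (sqrt h * sin t)" if "t \<in> S" for t
  proof -
    note rt = r[OF that]
    have "p (sqrt h * sin t) \<ge> 0"
    proof (cases "sqrt h * sin t > 0")
      case True
      then show ?thesis using V1_pos[OF \<phi>_pos[OF True]] rt sqrt_hs_pos by (simp add: p_def)
    next
      case False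
      then have neg: "sqrt h * sin t < 0" using rt(2) by linarith
      then have "V1 (\<phi> (sqrt h * sin t)) < 0"
        using V1_neg[OF \<phi>_inverse(1)[OF rt(1)] \<phi>_neg[OF rt(1)]] by simp
      then have "2 * (sqrt h * sin t) / V1 (\<phi> (sqrt h * sin t)) \<ge> 0"
        using neg by (intro divide_nonpos_neg) auto
      then show ?thesis using rt by (simp add: p_def)
    qed
    moreover have "h - V (g t) = h * (cos t)^2"
      using V_\<phi>[OF rt(1)] h by (simp add: g_def power_mult_distrib cos_squared_eq algebra_simps)
    then have "sqrt (h - V (g t)) = sqrt h * cos t"
      using rt(3) h by (simp add: real_sqrt_mult)
    ultimately show ?thesis using rt(3) h by (simp add: g'_def abs_mult)
  qed
  have pint: "(\<lambda>t. p (sqrt h * sin t)) absolutely_integrable_on {-pi/2..pi/2}"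
    by (intro absolutely_integrable_continuous_real continuous_on_compose2[OF continuous_p[of UNIV]])
       (auto intro!: continuous_intros)
  have "(\<lambda>t. p (sqrt h * sin t)) absolutely_integrable_on S"
    by (rule set_integrable_subset[OF pint Sm]) (auto simp: S_def)
  then have "(\<lambda>t. \<bar>g' t\<bar> * ?f (g t)) absolutely_integrable_on S"
    by (rule absolutely_integrable_spike[where S = "{}"]) (use integrand in auto)
  then have "integral (g ` S) ?f = integral S (\<lambda>t. \<bar>g' t\<bar> * ?f (g t))"
    using has_absolute_integral_change_of_variables_1'[OF Sm der inj, of ?f] by blast
  also have "\<dots> = integral S (\<lambda>t. p (sqrt h * sin t))"
    by (rule integral_cong) (rule integrand)
  also have "\<dots> = integral {-pi/2..pi/2} (\<lambda>t. p (sqrt h * sin t))"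
  proof (rule integral_spike_set)
    \<comment> \<open>The angles cut off contribute nothing because \<open>p\<close> vanishes there,
      so only three points remain.\<close>
    have "{t \<in> {-pi/2..pi/2} - S. p (sqrt h * sin t) \<noteq> 0} \<subseteq> {-pi/2, 0, pi/2}"
    proof
      fix t assume t: "t \<in> {t \<in> {-pi/2..pi/2} - S. p (sqrt h * sin t) \<noteq> 0}"
      then have "- sqrt hs < sqrt h * sin t" by (simp add: p_def not_le split: if_splits)
      with t have "\<not> (-pi/2 < t \<and> t < pi/2 \<and> t \<noteq> 0)" "-pi/2 \<le> t" "t \<le> pi/2"
        by (auto simp: S_def)
      then show "t \<in> {-pi/2, 0, pi/2}" unfolding insert_iff by linarith
    qed
    then show "negligible {t \<in> {-pi/2..pi/2} - S. p (sqrt h * sin t) \<noteq> 0}"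
      by (rule negligible_subset[rotated]) auto
    have "S \<subseteq> {-pi/2<..<pi/2}" unfolding S_def by blast
    then have "S - {-pi/2..pi/2} = {}" using greaterThanLessThan_subseteq_atLeastAtMost_iff by blast
    then have "{t \<in> S - {-pi/2..pi/2}. p (sqrt h * sin t) \<noteq> 0} = {}" by blast
    then show "negligible {t \<in> S - {-pi/2..pi/2}. p (sqrt h * sin t) \<noteq> 0}"
      by (simp only: negligible_empty)
  qed
  finally have "integral ?L ?f = integral {-pi/2..pi/2} (\<lambda>t. p (sqrt h * sin t))" unfolding img .
  moreover have "integral {\<phi> (- sqrt h)..\<phi> (sqrt h)} ?f = integral ?L ?f"
    unfolding level_set_eq[OF h]
  proof (rule integral_spike_set)
    show "negligible {x \<in> {\<phi> (- sqrt h)..\<phi> (sqrt h)} - ({\<phi> (- sqrt h)<..<\<phi> (sqrt h)} - {0}). ?f x \<noteq> 0}"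
      by (rule negligible_subset[of "{\<phi> (- sqrt h), 0, \<phi> (sqrt h)}"]) auto
    have "{x \<in> ({\<phi> (- sqrt h)<..<\<phi> (sqrt h)} - {0}) - {\<phi> (- sqrt h)..\<phi> (sqrt h)}. ?f x \<noteq> 0} = {}" by auto
    then show "negligible {x \<in> ({\<phi> (- sqrt h)<..<\<phi> (sqrt h)} - {0}) - {\<phi> (- sqrt h)..\<phi> (sqrt h)}. ?f x \<noteq> 0}"
      by (simp only: negligible_empty)
  qed
  ultimately show ?thesis by simp
qed

lemma u_plus_eq:
  assumes "h > 0"
  shows "u_plus V h = \<phi> (sqrt h)"
  unfolding u_plus_def
proof (rule the_equality)
  have "- sqrt hs < sqrt h" using real_sqrt_gt_zero[OF assms] sqrt_hs_pos by linarith
  then show "0 < \<phi> (sqrt h) \<and> V (\<phi> (sqrt h)) = h"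
    using assms \<phi>_pos[of "sqrt h"] V_\<phi>[of "sqrt h"] by simp
  fix u assume u: "0 < u \<and> V u = h"
  then have "\<sigma> u = sqrt h" by (simp add: \<sigma>_def)
  then show "u = \<phi> (sqrt h)" using u a_neg \<phi>_\<sigma>[of u] by simp
qed

lemma u_minus_eq:
  assumes "h > 0" "h < hs"
  shows "u_minus V a h = \<phi> (- sqrt h)"
  unfolding u_minus_def
proof (rule the_equality)
  have "- sqrt hs < - sqrt h" using assms by simp
  then show "a < \<phi> (- sqrt h) \<and> \<phi> (- sqrt h) < 0 \<and> V (\<phi> (- sqrt h)) = h"
    using assms \<phi>_neg[of "- sqrt h"] V_\<phi>[of "- sqrt h"] \<phi>_inverse(1)[of "- sqrt h"] by simp
  fix u assume u: "a < u \<and> u < 0 \<and> V u = h"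
  then have "\<sigma> u = - sqrt h" by (simp add: \<sigma>_def)
  then show "u = \<phi> (- sqrt h)" using u \<phi>_\<sigma>[of u] by simp
qed

lemma ext_period_eq:
  assumes "h > 0"
  shows "ext_period V a hs h = sqrt 2 * integral {-pi/2..pi/2} (\<lambda>t. p (sqrt h * sin t))"
proof (cases "h < hs")
  case True
  then show ?thesis
    using period_as_angular_average[OF assms] u_plus_eq[OF assms] u_minus_eq[OF assms]
    by (simp add: ext_period_def T_p_def)
next
  case False
  then have "\<phi> (- sqrt h) = a" by (simp add: \<phi>_def)
  then show ?thesis
    using period_as_angular_average[OF assms] u_plus_eq[OF assms] False
    by (simp add: ext_period_def T_b_def)
qed

section \<open>Positivity of the derivative of the period\<close>

lemma ext_period_deriv_pos:
  assumes h: "h > 0"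
  shows "\<exists>D>0. (ext_period V a hs has_real_derivative D) (at h)"
proof -
  define H where "H = (\<lambda>r. p r - 2 * M0 * r)"
  \<comment> \<open>The derivative of \<open>H\<close> off the two exceptional points. It has the
    sign of \<open>r\<close>: below \<open>- sqrt hs\<close> this is \<open>M0 > 0\<close>,
    elsewhere the comparison of \<open>M\<close> with \<open>M0\<close>.\<close>
  define \<kappa> where "\<kappa> = (\<lambda>r. (if r < - sqrt hs then 0 else 2 * M (\<phi> r)) - 2 * M0)"
  have avg: "integral {-pi/2..pi/2} (\<lambda>t. p (c * sin t)) = integral {-pi/2..pi/2} (\<lambda>t. H (c * sin t))" for c
  proof -
    have "(\<lambda>t. p (c * sin t)) integrable_on {-pi/2..pi/2}"
      by (intro integrable_continuous_real continuous_on_compose2[OF continuous_p[of UNIV]])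
         (auto intro!: continuous_intros)
    then have "((\<lambda>t. p (c * sin t) - 2 * M0 * c * sin t) has_integral
        integral {-pi/2..pi/2} (\<lambda>t. p (c * sin t)) - 2 * M0 * c * 0) {-pi/2..pi/2}"
      by (intro has_integral_diff has_integral_mult_right integrable_integral integral_sin_sym)
    then show ?thesis by (simp add: H_def mult.assoc integral_unique)
  qed
  have "\<exists>D>0. ((\<lambda>h. integral {-pi/2..pi/2} (\<lambda>t. H (sqrt h * sin t))) has_real_derivative D) (at h)"
  proof (rule angular_average_deriv_pos[where E = "{0, - sqrt hs}" and \<kappa> = \<kappa>])
    show "continuous_on UNIV H"
      unfolding H_def by (intro continuous_intros continuous_p)
  next
    fix r assume "r \<notin> {0, - sqrt hs}"
    then consider "r < - sqrt hs" | "- sqrt hs < r" "r < 0" | "0 < r" by fastforce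
    then have "(H has_real_derivative \<kappa> r) (at r) \<and> \<kappa> r * r > 0"
    proof cases
      case 1
      then have "r < 0" using sqrt_hs_pos by linarith
      then show ?thesis using 1 M0_pos dp_left[OF 1]
        by (auto simp: H_def \<kappa>_def mult_neg_neg mult_pos_neg intro!: derivative_eq_intros)
    next
      case 2
      then have "M (\<phi> r) < M0" using \<phi>_inverse \<phi>_neg by (intro M_less_M0) auto
      then show ?thesis using 2 dp[OF 2(1)]
        by (auto simp: H_def \<kappa>_def intro!: derivative_eq_intros mult_neg_neg)
    next
      case 3
      then have "M0 < M (\<phi> r)" using \<phi>_pos by (intro M0_less_M) auto
      moreover have "- sqrt hs < r" using 3 sqrt_hs_pos by linarith
      ultimately show ?thesis using 3 dp[of r]
        by (auto simp: H_def \<kappa>_def intro!: derivative_eq_intros)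
    qed
    then show "(H has_real_derivative \<kappa> r) (at r)" "\<kappa> r * r > 0" by auto
  next
    fix R :: real
    \<comment> \<open>A positive bound, so that \<open>R'\<close> lies in the range where
      \<open>\<phi>\<close> is strictly increasing even if \<open>R\<close> does not.\<close>
    define R' where "R' = max R 1"
    \<comment> \<open>Filling in the limit at \<open>0\<close> makes \<open>M\<close> continuous on
      a compact interval, hence bounded on the right. On the left, \<open>M\<close> is bounded up to
      \<open>a\<close> by lying between \<open>0\<close> and \<open>M0\<close>.\<close>
    define Mc where "Mc = (\<lambda>u. if u = 0 then M0 else M u)"
    have cont: "continuous_on {0..\<phi> R'} Mc"
      unfolding Mc_def
    proof (rule continuous_at_imp_continuous_on, rule ballI)
      fix u assume "u \<in> {0..\<phi> R'}"
      then have "a < u" using a_neg by simp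
      show "isCont (\<lambda>u. if u = 0 then M0 else M u) u"
      proof (cases "u = 0")
        case True
        have "((\<lambda>u. if u = 0 then M0 else M u) \<longlongrightarrow> M0) (at 0)"
          by (rule Lim_transform_eventually[OF tendsto_M_0]) (auto simp: eventually_at_filter)
        then show ?thesis using True by (simp add: isCont_def)
      next
        case False
        then have "\<forall>\<^sub>F x in nhds u. x \<in> - {0}"
          by (intro eventually_nhds_in_open) auto
        then have "\<forall>\<^sub>F x in nhds u. (if x = 0 then M0 else M x) = M x"
          by eventually_elim auto
        moreover have "isCont M u" using dM[OF \<open>a < u\<close> False] DERIV_isCont by blast
        ultimately show ?thesis by (simp add: isCont_cong)
      qed
    qed
    have "bounded (Mc ` {0..\<phi> R'})"
      by (intro compact_imp_bounded compact_continuous_image[OF cont]) simp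
    then obtain B where "\<forall>x \<in> Mc ` {0..\<phi> R'}. norm x \<le> B"
      unfolding bounded_iff by blast
    then have B: "\<bar>M u\<bar> \<le> B" if "0 < u" "u \<le> \<phi> R'" for u
      using that by (force simp: Mc_def)
    have "\<bar>\<kappa> r\<bar> \<le> 2 * \<bar>B\<bar> + 2 * M0" if r: "r \<notin> {0, - sqrt hs}" "\<bar>r\<bar> \<le> R" for r
    proof -
      consider "r < - sqrt hs" | "- sqrt hs < r" "r < 0" | "0 < r" using r by fastforce
      then show ?thesis
      proof cases
        case 1
        then show ?thesis using M0_pos by (simp add: \<kappa>_def)
      next
        case 2
        then have "M (\<phi> r) < M0" "M (\<phi> r) \<ge> 0"
          using \<phi>_inverse \<phi>_neg by (intro M_less_M0 M_nonneg_left; auto)+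
        then show ?thesis using 2 by (simp add: \<kappa>_def)
      next
        case 3
        have "r \<le> R'" "- sqrt hs < r" "- sqrt hs < R'"
          using r 3 sqrt_hs_pos unfolding R'_def by linarith+
        then have "\<phi> r \<le> \<phi> R'" using \<phi>_less_iff[of R' r] by linarith
        then have "\<bar>M (\<phi> r)\<bar> \<le> B" using B[of "\<phi> r"] \<phi>_pos[OF 3] by simp
        moreover have "\<not> r < - sqrt hs" using 3 sqrt_hs_pos by linarith
        ultimately show ?thesis using M0_pos by (simp add: \<kappa>_def)
      qed
    qed
    then show "\<exists>B. \<forall>r. r \<notin> {0, - sqrt hs} \<longrightarrow> \<bar>r\<bar> \<le> R \<longrightarrow> \<bar>\<kappa> r\<bar> \<le> B" by blast
  qed (use h in auto)
  then obtain D where "D > 0 \<and>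
      ((\<lambda>h. integral {-pi/2..pi/2} (\<lambda>t. H (sqrt h * sin t))) has_real_derivative D) (at h)" ..
  note D = conjunct1[OF this] conjunct2[OF this]
  have "((\<lambda>h. sqrt 2 * integral {-pi/2..pi/2} (\<lambda>t. H (sqrt h * sin t)))
      has_real_derivative sqrt 2 * D) (at h)"
    using D(2) by (rule DERIV_cmult)
  then have "(ext_period V a hs has_real_derivative sqrt 2 * D) (at h)"
  proof (rule has_field_derivative_transform_within_open)
    show "sqrt 2 * integral {-pi/2..pi/2} (\<lambda>t. H (sqrt x * sin t)) = ext_period V a hs x"
      if "x \<in> {0<..}" for x
      using that by (simp only: ext_period_eq avg greaterThan_iff)
  qed (use h in auto)
  then show ?thesis using D(1) by (intro exI[of _ "sqrt 2 * D"]) auto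
qed

end

section \<open>Instantiation with the iterated derivatives of \<open>V\<close>\<close>

theorem theorem2p3:
  fixes V :: "real \<Rightarrow> real" and a hs :: real
  assumes a_neg: "a < 0"
    and C4: "Ck_on 4 {a<..} V"
    and lim_V: "(V \<longlongrightarrow> hs) (at_right a)"
    and hs_pos: "hs > 0"
    and lim_dV: "filterlim (deriv V) at_bot (at_right a)"
    and V0: "V 0 = 0" and dV0: "deriv V 0 = 0" and ddV0: "nderiv 2 V 0 > 0"
    and sign: "\<And>u. u \<in> {a<..} - {0} \<Longrightarrow> u * deriv V u > 0"
    and V_inf: "filterlim V at_top at_top"
    and cond_a: "\<And>u. u \<in> {a<..} \<Longrightarrow> nderiv 2 V u > 0 \<Longrightarrow>
                   5 * (nderiv 3 V u)^2 - 3 * nderiv 2 V u * nderiv 4 V u > 0"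
    and cond_b: "\<And>u. u \<in> {a<..} \<Longrightarrow> nderiv 2 V u = 0 \<Longrightarrow>
                   deriv V u * nderiv 3 V u < 0"
  shows "\<forall>h>0. \<exists>D. (ext_period V a hs has_real_derivative D) (at h) \<and> D > 0"
proof -
  have der: "(nderiv j V has_real_derivative nderiv (Suc j) V u) (at u)" if "j < 4" "a < u" for j u
    using C4 that by (auto simp: Ck_on_def)
  have nd: "nderiv 0 V = V" "nderiv (Suc 0) V = deriv V"
    by (simp_all add: nderiv_def)
  interpret schaaf_potential V "deriv V" "nderiv 2 V" "nderiv 3 V" "nderiv 4 V" a hs
  proof (unfold_locales, goal_cases)
    case (3 u)
    then show ?case using der[of 0 u] nd(1,2) by simp
  next
    case (4 u)
    then show ?case using der[of "Suc 0" u] nd(2) by (simp add: numeral_2_eq_2)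
  next
    case (5 u)
    then show ?case using der[of 2 u] by (simp add: eval_nat_numeral)
  next
    case (6 u)
    then show ?case using der[of 3 u] by (simp add: eval_nat_numeral)
  next
    case (12 u)
    then show ?case by (intro sign) auto
  next
    case (14 u)
    then show ?case by (intro cond_a) auto
  next
    case (15 u)
    then show ?case by (intro cond_b) auto
  qed (fact a_neg hs_pos lim_V lim_dV V0 dV0 ddV0 V_inf)+
  show ?thesis using ext_period_deriv_pos by blast
qed

end
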